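(* Let $(M,g)$ be an $n$-dimensional Riemannian manifold and let $k\ge0$ be an integer with $0\le 2k<n$. If the Einstein-Lovelock tensor $T_{2k}$ of $(M,g)$ is positive definite (or negative definite), then the operator $\ell_{2k}$ is elliptic.
   Context: Double forms. On an $n$-dimensional Euclidean vector space $(V,g)$, a $(p,q)$-double form is an element of $\Lambda^pV^*\otimes\Lambda^qV^*$, viewed as a bilinear form $\Lambda^pV\times\Lambda^qV\to\mathbb R$. The exterior product is $(\theta_1\otimes\theta_2)(\theta_3\otimes\theta_4)=(\theta_1\wedge\theta_3)\otimes(\theta_2\wedge\theta_4)$, so that $B^k(x_1\wedge\dots\wedge x_k,y_1\wedge\dots\wedge y_k)=k!\det[B(x_i,y_j)]$ for a symmetric bilinear form $B$. The generalized Hodge star on $(p,q)$-double forms is $*\omega(\cdot,\cdot)=(-1)^{(p+q)(n-p-q)}\omega( *\cdot,*\cdot)$, with the usual Hodge star on the right. For $(1,1)$-double forms, $\langle S,T\rangle=\sum_{i,j}S(e_i,e_j)T(e_i,e_j)$ with $(e_i)$ orthonormal. These operations are applied pointwise on tangent spaces. The Riemann tensor $R$ of $(M,g)$ is viewed as a symmetric $(2,2)$-double form, with sign such that $R(x\wedge y,x\wedge y)$ is the sectional curvature for orthonormal $x,y$. The $(2k)$-th Einstein-Lovelock tensor is the symmetric bilinear form $T_{2k}=*\frac{1}{(n-2k-1)!}g^{n-2k-1}R^k$ for $2k<n$ (so $T_0=g$). For a smooth function $f$, $\ell_{2k}(f)=-\langle T_{2k},\mathrm{Hess}(f)\rangle$.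 *)

theory Defs
  imports "HOL-Analysis.Analysis"
begin

section \<open>Smooth functions on open subsets of coordinate space\<close>

definition pderiv_at :: "'n::finite \<Rightarrow> (real^'n \<Rightarrow> real) \<Rightarrow> real^'n \<Rightarrow> real" where
  "pderiv_at i f x = frechet_derivative f (at x) (axis i 1)"

text \<open>The set \<open>S\<close> is meant to be open.\<close>

primrec Ck_on :: "nat \<Rightarrow> (real^'n::finite) set \<Rightarrow> (real^'n \<Rightarrow> real) \<Rightarrow> bool" where
  "Ck_on 0 S f \<longleftrightarrow> continuous_on S f"
| "Ck_on (Suc m) S f \<longleftrightarrow>
     (\<forall>x\<in>S. f differentiable (at x)) \<and> (\<forall>i. Ck_on m S (pderiv_at i f))"

definition smooth_on :: "(real^'n::finite) set \<Rightarrow> (real^'n \<Rightarrow> real) \<Rightarrow> bool" where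
  "smooth_on S f \<longleftrightarrow> (\<forall>m. Ck_on m S f)"


section \<open>Smooth manifolds and Riemannian metrics\<close>

text \<open>
  A chart is a pair of a coordinate neighbourhood \<open>U\<close> and a coordinate map, whose values
  outside \<open>U\<close> are irrelevant. The dimension of the manifold is \<open>CARD('n)\<close>.
\<close>

type_synonym ('a, 'n) chart = "'a set \<times> ('a \<Rightarrow> real^'n)"

definition chart_image :: "('a, 'n::finite) chart \<Rightarrow> (real^'n) set" where
  "chart_image c = snd c ` fst c"

definition chart_inv :: "('a, 'n::finite) chart \<Rightarrow> real^'n \<Rightarrow> 'a" where
  "chart_inv c = inv_into (fst c) (snd c)"

definition transition :: "('a, 'n::finite) chart \<Rightarrow> ('a, 'n) chart \<Rightarrow> real^'n \<Rightarrow> real^'n" where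
  "transition c d = snd d \<circ> chart_inv c"

definition smooth_manifold :: "'a topology \<Rightarrow> ('a, 'n::finite) chart set \<Rightarrow> bool" where
  "smooth_manifold X A \<longleftrightarrow>
     Hausdorff_space X \<and> second_countable X \<and>
     topspace X = (\<Union>c\<in>A. fst c) \<and>
     (\<forall>c\<in>A. openin X (fst c) \<and> open (chart_image c) \<and>
        homeomorphic_map (subtopology X (fst c)) (top_of_set (chart_image c)) (snd c)) \<and>
     (\<forall>c\<in>A. \<forall>d\<in>A. \<forall>i. smooth_on (snd c ` (fst c \<inter> fst d)) (\<lambda>x. transition c d x $ i))"

definition smooth_fun :: "('a, 'n::finite) chart set \<Rightarrow> ('a \<Rightarrow> real) \<Rightarrow> bool" where
  "smooth_fun A f \<longleftrightarrow> (\<forall>c\<in>A. smooth_on (chart_image c) (f \<circ> chart_inv c))"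

text \<open>
  Tensor fields are given by their components in each chart; a metric is a family of matrix
  fields \<open>g c x\<close>, one for each chart \<open>c\<close>, defined at the points \<open>x\<close> of the image of \<open>c\<close> and
  related by the transformation rule of covariant 2-tensors.
\<close>

type_synonym ('a, 'n) metric = "('a, 'n) chart \<Rightarrow> real^'n \<Rightarrow> real^'n^'n"

definition bilin :: "real^'n^'n \<Rightarrow> real^'n::finite \<Rightarrow> real^'n \<Rightarrow> real" where
  "bilin G u v = (\<Sum>i\<in>UNIV. \<Sum>j\<in>UNIV. G $ i $ j * u $ i * v $ j)"

definition riemannian_metric :: "('a, 'n::finite) chart set \<Rightarrow> ('a, 'n) metric \<Rightarrow> bool" where
  "riemannian_metric A g \<longleftrightarrow>
     (\<forall>c\<in>A. (\<forall>i j. smooth_on (chart_image c) (\<lambda>x. g c x $ i $ j)) \<and>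
        (\<forall>x\<in>chart_image c. (\<forall>i j. g c x $ i $ j = g c x $ j $ i) \<and>
           (\<forall>v. v \<noteq> 0 \<longrightarrow> bilin (g c x) v v > 0))) \<and>
     (\<forall>c\<in>A. \<forall>d\<in>A. \<forall>x\<in>snd c ` (fst c \<inter> fst d). \<forall>i j.
        g c x $ i $ j =
          (\<Sum>k\<in>UNIV. \<Sum>l\<in>UNIV. g d (transition c d x) $ k $ l *
             pderiv_at i (\<lambda>y. transition c d y $ k) x * pderiv_at j (\<lambda>y. transition c d y $ l) x))"

definition riemannian_manifold ::
    "'a topology \<Rightarrow> ('a, 'n::finite) chart set \<Rightarrow> ('a, 'n) metric \<Rightarrow> bool" where
  "riemannian_manifold X A g \<longleftrightarrow> smooth_manifold X A \<and> riemannian_metric A g"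


section \<open>Levi-Civita connection, Hessian and curvature in a chart\<close>

text \<open>Here \<open>G\<close> is the matrix field of the metric in a fixed chart.\<close>

definition christoffel :: "(real^'n \<Rightarrow> real^'n^'n) \<Rightarrow> 'n::finite \<Rightarrow> 'n \<Rightarrow> 'n \<Rightarrow> real^'n \<Rightarrow> real" where
  "christoffel G k i j x =
     1/2 * (\<Sum>l\<in>UNIV. matrix_inv (G x) $ k $ l *
        (pderiv_at i (\<lambda>y. G y $ j $ l) x + pderiv_at j (\<lambda>y. G y $ i $ l) x
          - pderiv_at l (\<lambda>y. G y $ i $ j) x))"

definition hessian ::
    "(real^'n \<Rightarrow> real^'n^'n) \<Rightarrow> (real^'n \<Rightarrow> real) \<Rightarrow> real^'n::finite \<Rightarrow> real^'n \<Rightarrow> real^'n \<Rightarrow> real" where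
  "hessian G F x u v =
     (\<Sum>i\<in>UNIV. \<Sum>j\<in>UNIV. u $ i * v $ j *
        (pderiv_at i (pderiv_at j F) x - (\<Sum>k\<in>UNIV. christoffel G k i j x * pderiv_at k F x)))"

text \<open>
  The \<open>l\<close>-th component of \<open>R(\<partial>\<^sub>i, \<partial>\<^sub>j) \<partial>\<^sub>k = \<nabla>\<^sub>i \<nabla>\<^sub>j \<partial>\<^sub>k - \<nabla>\<^sub>j \<nabla>\<^sub>i \<partial>\<^sub>k\<close>.
\<close>

definition curvature_op ::
    "(real^'n \<Rightarrow> real^'n^'n) \<Rightarrow> 'n::finite \<Rightarrow> 'n \<Rightarrow> 'n \<Rightarrow> 'n \<Rightarrow> real^'n \<Rightarrow> real" where
  "curvature_op G i j k l x =
     pderiv_at i (christoffel G l j k) x - pderiv_at j (christoffel G l i k) x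
     + (\<Sum>m\<in>UNIV. christoffel G l i m x * christoffel G m j k x
                 - christoffel G l j m x * christoffel G m i k x)"

text \<open>
  \<open>R(u \<and> v, w \<and> z) = g(R(u, v) z, w)\<close>; with this sign \<open>R(u \<and> v, u \<and> v) = g(R(u, v) v, u)\<close> is
  the sectional curvature for orthonormal \<open>u\<close>, \<open>v\<close>.
\<close>

definition riemann ::
    "(real^'n \<Rightarrow> real^'n^'n) \<Rightarrow> real^'n \<Rightarrow> real^'n::finite \<Rightarrow> real^'n \<Rightarrow> real^'n \<Rightarrow> real^'n \<Rightarrow> real" where
  "riemann G x u v w z =
     (\<Sum>i\<in>UNIV. \<Sum>j\<in>UNIV. \<Sum>a\<in>UNIV. \<Sum>k\<in>UNIV. u $ i * v $ j * w $ a * z $ k *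
        (\<Sum>l\<in>UNIV. G x $ l $ a * curvature_op G i j k l x))"


section \<open>Double forms\<close>

text \<open>
  An element of the direct sum of all \<open>\<Lambda>\<^sup>p V* \<otimes> \<Lambda>\<^sup>q V*\<close> is represented by its values
  \<open>\<omega> [x\<^sub>1, \<dots>, x\<^sub>p] [y\<^sub>1, \<dots>, y\<^sub>q]\<close> on pairs of decomposable vectors \<open>x\<^sub>1 \<and> \<dots> \<and> x\<^sub>p\<close> and
  \<open>y\<^sub>1 \<and> \<dots> \<and> y\<^sub>q\<close>; the lengths of the lists select the component of degree \<open>(p, q)\<close>.
\<close>

type_synonym 'v double_form = "'v list \<Rightarrow> 'v list \<Rightarrow> real"

text \<open>
  Sign of the shuffle that lists the elements of \<open>I\<close>, then those of \<open>{..<m} - I\<close>, both in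
  increasing order.
\<close>

definition shuffle_sign :: "nat \<Rightarrow> nat set \<Rightarrow> real" where
  "shuffle_sign m I = (- 1) ^ card {(a, b). a < b \<and> b < m \<and> a \<notin> I \<and> b \<in> I}"

text \<open>
  Bilinear extension of \<open>(\<theta>\<^sub>1 \<otimes> \<theta>\<^sub>2)(\<theta>\<^sub>3 \<otimes> \<theta>\<^sub>4) = (\<theta>\<^sub>1 \<and> \<theta>\<^sub>3) \<otimes> (\<theta>\<^sub>2 \<and> \<theta>\<^sub>4)\<close>, where
  \<open>(\<alpha> \<and> \<beta>)(x\<^sub>1, \<dots>, x\<^sub>m)\<close> is the signed sum over all shuffles of \<open>\<alpha>(x\<^sub>I) \<beta>(x\<^sub>J)\<close>, \<open>J\<close> being
  the complement of \<open>I\<close>.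
\<close>

definition df_mult :: "'v double_form \<Rightarrow> 'v double_form \<Rightarrow> 'v double_form" where
  "df_mult \<omega> \<eta> xs ys =
     (\<Sum>I\<in>Pow {..<length xs}. \<Sum>J\<in>Pow {..<length ys}.
        shuffle_sign (length xs) I * shuffle_sign (length ys) J *
        \<omega> (nths xs I) (nths ys J) * \<eta> (nths xs (- I)) (nths ys (- J)))"

definition df_one :: "'v double_form" where
  "df_one xs ys = (if xs = [] \<and> ys = [] then 1 else 0)"

primrec df_power :: "'v double_form \<Rightarrow> nat \<Rightarrow> 'v double_form" where
  "df_power \<omega> 0 = df_one"
| "df_power \<omega> (Suc m) = df_mult \<omega> (df_power \<omega> m)"

definition df_scale :: "real \<Rightarrow> 'v double_form \<Rightarrow> 'v double_form" where
  "df_scale r \<omega> xs ys = r * \<omega> xs ys"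

definition df11 :: "('v \<Rightarrow> 'v \<Rightarrow> real) \<Rightarrow> 'v double_form" where
  "df11 B xs ys = (case (xs, ys) of ([x], [y]) \<Rightarrow> B x y | _ \<Rightarrow> 0)"

definition df22 :: "('v \<Rightarrow> 'v \<Rightarrow> 'v \<Rightarrow> 'v \<Rightarrow> real) \<Rightarrow> 'v double_form" where
  "df22 R xs ys = (case (xs, ys) of ([x1, x2], [y1, y2]) \<Rightarrow> R x1 x2 y1 y2 | _ \<Rightarrow> 0)"


section \<open>Hodge star\<close>

definition orthonormal_frame :: "(real^'n::finite \<Rightarrow> real^'n \<Rightarrow> real) \<Rightarrow> (real^'n) list \<Rightarrow> bool" where
  "orthonormal_frame h e \<longleftrightarrow> length e = CARD('n) \<and>
     (\<forall>i<CARD('n). \<forall>j<CARD('n). h (e ! i) (e ! j) = (if i = j then 1 else 0))"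

text \<open>
  The orthonormal frame also fixes the orientation. None of the operations on double forms below
  depends on the choice, since the Hodge star is always applied to both arguments.
\<close>

definition frame :: "(real^'n::finite \<Rightarrow> real^'n \<Rightarrow> real) \<Rightarrow> (real^'n) list" where
  "frame h = (SOME e. orthonormal_frame h e)"

text \<open>The inner product of \<open>x\<^sub>1 \<and> \<dots> \<and> x\<^sub>m\<close> and \<open>y\<^sub>1 \<and> \<dots> \<and> y\<^sub>m\<close> for lists of equal length.\<close>

definition gram :: "('v \<Rightarrow> 'v \<Rightarrow> real) \<Rightarrow> 'v list \<Rightarrow> 'v list \<Rightarrow> real" where
  "gram h xs ys =
     (\<Sum>\<sigma> | \<sigma> permutes {..<length xs}. of_int (sign \<sigma>) * (\<Prod>i<length xs. h (xs ! i) (ys ! \<sigma> i)))"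

text \<open>
  A \<open>p\<close>-vector is represented by the linear functional by which it acts on alternating \<open>p\<close>-forms;
  \<open>x\<^sub>1 \<and> \<dots> \<and> x\<^sub>p\<close> is \<open>\<lambda>\<alpha>. \<alpha> [x\<^sub>1, \<dots>, x\<^sub>p]\<close>.
\<close>

type_synonym 'v multivector = "('v list \<Rightarrow> real) \<Rightarrow> real"

text \<open>
  \<open>hodge h xs\<close> is \<open>*(x\<^sub>1 \<and> \<dots> \<and> x\<^sub>m)\<close>. The star is the linear map with
  \<open>*e\<^sub>I = shuffle_sign n I \<cdot> e\<^sub>J\<close>, \<open>J\<close> the complement of \<open>I\<close>, and
  \<open>x\<^sub>1 \<and> \<dots> \<and> x\<^sub>m\<close> is the sum of all \<open>\<langle>x\<^sub>1 \<and> \<dots> \<and> x\<^sub>m, e\<^sub>I\<rangle> e\<^sub>I\<close> with \<open>I\<close> of size \<open>m\<close>.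
\<close>

definition hodge ::
    "(real^'n::finite \<Rightarrow> real^'n \<Rightarrow> real) \<Rightarrow> (real^'n) list \<Rightarrow> (real^'n) multivector" where
  "hodge h xs = (\<lambda>\<alpha>. \<Sum>I | I \<subseteq> {..<CARD('n)} \<and> card I = length xs.
     gram h xs (nths (frame h) I) * (shuffle_sign (CARD('n)) I * \<alpha> (nths (frame h) (- I))))"

definition df_eval :: "'v double_form \<Rightarrow> 'v multivector \<Rightarrow> 'v multivector \<Rightarrow> real" where
  "df_eval \<omega> X Y = X (\<lambda>u. Y (\<lambda>v. \<omega> u v))"

text \<open>
  On arguments of lengths \<open>n - p\<close> and \<open>n - q\<close> only the \<open>(p, q)\<close>-component of \<open>\<omega>\<close> contributes.
  The exponent is an integer since \<open>n - p - q\<close> may be negative.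
\<close>

definition df_star ::
    "(real^'n::finite \<Rightarrow> real^'n \<Rightarrow> real) \<Rightarrow> (real^'n) double_form \<Rightarrow> (real^'n) double_form" where
  "df_star h \<omega> xs ys =
     (let n = int (CARD('n)); p = n - int (length xs); q = n - int (length ys)
      in (- 1) powi ((p + q) * (n - p - q)) * df_eval \<omega> (hodge h xs) (hodge h ys))"

definition inner11 ::
    "(real^'n::finite \<Rightarrow> real^'n \<Rightarrow> real) \<Rightarrow>
     (real^'n \<Rightarrow> real^'n \<Rightarrow> real) \<Rightarrow> (real^'n \<Rightarrow> real^'n \<Rightarrow> real) \<Rightarrow> real" where
  "inner11 h S T =
     (\<Sum>i<CARD('n). \<Sum>j<CARD('n).
        S (frame h ! i) (frame h ! j) * T (frame h ! i) (frame h ! j))"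


section \<open>Einstein-Lovelock tensors and the associated operators\<close>

text \<open>\<open>T\<^bsub>2k\<^esub>\<close> at the point with coordinates \<open>x\<close>, for \<open>2k < n\<close>.\<close>

definition einstein_lovelock ::
    "nat \<Rightarrow> (real^'n \<Rightarrow> real^'n^'n) \<Rightarrow> real^'n::finite \<Rightarrow> real^'n \<Rightarrow> real^'n \<Rightarrow> real" where
  "einstein_lovelock k G x u v =
     (let h = bilin (G x); m = CARD('n) - 2 * k - 1
      in df_star h (df_scale (1 / fact m)
           (df_mult (df_power (df11 h) m) (df_power (df22 (riemann G x)) k))) [u] [v])"

definition lovelock_positive_definite ::
    "('a, 'n::finite) chart set \<Rightarrow> ('a, 'n) metric \<Rightarrow> nat \<Rightarrow> bool" where
  "lovelock_positive_definite A g k \<longleftrightarrow>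
     (\<forall>c\<in>A. \<forall>x\<in>chart_image c. \<forall>v. v \<noteq> 0 \<longrightarrow> einstein_lovelock k (g c) x v v > 0)"

definition lovelock_negative_definite ::
    "('a, 'n::finite) chart set \<Rightarrow> ('a, 'n) metric \<Rightarrow> nat \<Rightarrow> bool" where
  "lovelock_negative_definite A g k \<longleftrightarrow>
     (\<forall>c\<in>A. \<forall>x\<in>chart_image c. \<forall>v. v \<noteq> 0 \<longrightarrow> einstein_lovelock k (g c) x v v < 0)"

definition chart_at :: "('a, 'n::finite) chart set \<Rightarrow> 'a \<Rightarrow> ('a, 'n) chart" where
  "chart_at A p = (SOME c. c \<in> A \<and> p \<in> fst c)"

text \<open>
  \<open>\<l>\<^bsub>2k\<^esub>(f) = - \<langle>T\<^bsub>2k\<^esub>, Hess f\<rangle>\<close>, computed at \<open>p\<close> in an arbitrarily chosen chart around \<open>p\<close>;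
  the value does not depend on the chart.
\<close>

definition lovelock_operator ::
    "('a, 'n::finite) chart set \<Rightarrow> ('a, 'n) metric \<Rightarrow> nat \<Rightarrow> ('a \<Rightarrow> real) \<Rightarrow> 'a \<Rightarrow> real" where
  "lovelock_operator A g k f p =
     (let c = chart_at A p; x = snd c p
      in - inner11 (bilin (g c x)) (einstein_lovelock k (g c) x)
             (hessian (g c) (f \<circ> chart_inv c) x))"


section \<open>Elliptic operators of second order\<close>

text \<open>
  A linear differential operator of order 2 with smooth coefficients, acting on smooth functions,
  whose principal symbol \<open>\<xi> \<mapsto> \<Sum> a\<^bsub>ij\<^esub> \<xi>\<^sub>i \<xi>\<^sub>j\<close> vanishes for no nonzero covector \<open>\<xi>\<close>.
\<close>

definition elliptic_operator ::
    "('a, 'n::finite) chart set \<Rightarrow> (('a \<Rightarrow> real) \<Rightarrow> 'a \<Rightarrow> real) \<Rightarrow> bool" where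
  "elliptic_operator A P \<longleftrightarrow>
     (\<forall>c\<in>A. \<exists>(a :: 'n \<Rightarrow> 'n \<Rightarrow> real^'n \<Rightarrow> real) (b :: 'n \<Rightarrow> real^'n \<Rightarrow> real) (s :: real^'n \<Rightarrow> real).
        (\<forall>i j. smooth_on (chart_image c) (a i j)) \<and>
        (\<forall>i. smooth_on (chart_image c) (b i)) \<and>
        smooth_on (chart_image c) s \<and>
        (\<forall>f. smooth_fun A f \<longrightarrow> (\<forall>x\<in>chart_image c.
           P f (chart_inv c x) =
             (let F = f \<circ> chart_inv c
              in (\<Sum>i\<in>UNIV. \<Sum>j\<in>UNIV. a i j x * pderiv_at i (pderiv_at j F) x)
                 + (\<Sum>i\<in>UNIV. b i x * pderiv_at i F x) + s x * F x))) \<and>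
        (\<forall>x\<in>chart_image c. \<forall>\<xi> :: real^'n. \<xi> \<noteq> 0 \<longrightarrow>
           (\<Sum>i\<in>UNIV. \<Sum>j\<in>UNIV. a i j x * \<xi> $ i * \<xi> $ j) \<noteq> 0))"

end

theory Submission
  imports Defs
begin

text \<open>
  With \<open>\<omega> = g\<^bsup>m\<^esup> R\<^bsup>k\<^esup> / m!\<close> and \<open>m = n - 2k - 1\<close>, so that \<open>T\<^bsub>2k\<^esub> = * \<omega>\<close>, expanding the Hodge star
  gives \<open>\<langle>T\<^bsub>2k\<^esub>, B\<rangle> = (B \<omega>)(e, e)\<close> for every bilinear form \<open>B\<close> and orthonormal frame \<open>e\<close>, where
  \<open>B \<omega>\<close> has top degree \<open>(n, n)\<close>. Top degree forms scale by determinants, so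
  \<open>\<langle>T\<^bsub>2k\<^esub>, B\<rangle> = (B \<omega>)(b, b) / det G\<close> for the coordinate basis \<open>b\<close>. Together with the
  transformation laws of the Hessian and the curvature this shows that \<open>\<l>\<^bsub>2k\<^esub>\<close> does not depend on
  the chart, and that its coefficients are smooth. The choice \<open>B = \<xi> \<otimes> \<xi>\<close> gives the principal symbol
  \<open>- T\<^bsub>2k\<^esub>(v, v)\<close>, with \<open>v\<close> the vector dual to \<open>\<xi>\<close>.
\<close>

section \<open>Products of alternating forms\<close>

text \<open>Two choices stand in the way. \<open>frame\<close> is chosen separately at every point,
  so smooth dependence on the point cannot be read off from expressions containing it.
  \<open>chart_at\<close> may also select a different chart at every point, so the coefficients of
  the operator in a prescribed chart are not visible in its definition. One device removes both: in
  top degree, exchanging a basis costs a determinant, and it enters squared because both slots of a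
  double form change. For an orthonormal frame the square equals 1 / det G; for a change of chart it
  cancels against the factor picked up by det G. The price is that the curvature must alternate in
  each of its two pairs of arguments. In the first pair this is visible in the formula for
  \<open>curvature_op\<close>; in the second it results from differentiating the compatibility of
  metric and connection, together with the symmetry of second partial derivatives.\<close>

definition wedge :: "('v list \<Rightarrow> real) \<Rightarrow> ('v list \<Rightarrow> real) \<Rightarrow> 'v list \<Rightarrow> real" where
  "wedge \<alpha> \<beta> xs = (\<Sum>I\<in>Pow {..<length xs}.
     shuffle_sign (length xs) I * \<alpha> (nths xs I) * \<beta> (nths xs (- I)))"

text \<open>The sign counts pairs with a smaller element outside the set and a larger one inside.
  Index 0, lying in the set, has nothing below it and enters no such pair; all other pairs are
  shifted by one.\<close>

lemma shuffle_sign_insert_0: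
  "shuffle_sign (Suc m) (insert 0 (Suc ` I)) = shuffle_sign m I"
proof -
  have "{(a, b). a < b \<and> b < Suc m \<and> a \<notin> insert 0 (Suc ` I) \<and> b \<in> insert 0 (Suc ` I)}
      = map_prod Suc Suc ` {(a, b). a < b \<and> b < m \<and> a \<notin> I \<and> b \<in> I}" (is "?L = ?R")
  proof (rule set_eqI, clarify)
    fix a b show "(a, b) \<in> ?L \<longleftrightarrow> (a, b) \<in> ?R"
      by (cases a; cases b) (auto simp: image_iff)
  qed
  then show ?thesis
    unfolding shuffle_sign_def by (simp add: card_image inj_on_def)
qed

text \<open>Now 0 lies outside the set and below all its elements, which adds one pair for each
  element of \<open>I\<close>.\<close>

lemma shuffle_sign_image_Suc:
  assumes "I \<subseteq> {..<m}"
  shows "shuffle_sign (Suc m) (Suc ` I) = (- 1) ^ card I * shuffle_sign m I"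
proof -
  let ?A = "{(a, b). a < b \<and> b < m \<and> a \<notin> I \<and> b \<in> I}"
  have eq: "{(a, b). a < b \<and> b < Suc m \<and> a \<notin> Suc ` I \<and> b \<in> Suc ` I}
      = map_prod Suc Suc ` ?A \<union> (\<lambda>b. (0, Suc b)) ` I" (is "?L = ?R")
  proof (rule set_eqI, clarify)
    fix a b show "(a, b) \<in> ?L \<longleftrightarrow> (a, b) \<in> ?R"
      using assms by (cases a; cases b) (auto simp: image_iff)
  qed
  have fin: "finite I" "finite ?A"
    using assms finite_subset by (blast, auto intro: finite_subset[of _ "{..<m} \<times> {..<m}"])
  have "card ?R = card ?A + card I"
    using fin by (subst card_Un_disjoint) (auto simp: card_image inj_on_def)
  then show ?thesis
    unfolding shuffle_sign_def eq by (simp add: power_add)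
qed

lemma Pow_lessThan_Suc:
  "Pow {..<Suc m} = (\<lambda>I. insert 0 (Suc ` I)) ` Pow {..<m} \<union> (`) Suc ` Pow {..<m}"
  proof -
  have "Pow (Suc ` {..<m}) = (`) Suc ` Pow {..<m}"
    by (rule image_Pow_surj[symmetric, OF refl])
  then show ?thesis
    unfolding lessThan_Suc_eq_insert_0 Pow_insert by (simp add: image_image Un_commute)
qed

lemma length_nths_subset: "I \<subseteq> {..<length xs} \<Longrightarrow> length (nths xs I) = card I"
  unfolding length_nths by (rule arg_cong[where f=card]) auto

text \<open>The subsets are split by whether they contain 0, that is, by whether \<open>x\<close>
  becomes an argument of the left or of the right factor. In the second case \<open>x\<close> passes
  all arguments of \<alpha>, whence the sign. This recursion lets later proofs proceed by list
  induction instead of shuffle combinatorics.\<close>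

lemma wedge_Cons:
  "wedge \<alpha> \<beta> (x # xs) =
     wedge (\<lambda>u. \<alpha> (x # u)) \<beta> xs + wedge (\<lambda>u. (- 1) ^ length u * \<alpha> u) (\<lambda>v. \<beta> (x # v)) xs"
proof -
  let ?f = "\<lambda>I. shuffle_sign (Suc (length xs)) I * \<alpha> (nths (x # xs) I) * \<beta> (nths (x # xs) (- I))"
  let ?P = "Pow {..<length xs}"
  have inj: "inj_on (\<lambda>I. insert 0 (Suc ` I)) ?P" "inj_on ((`) Suc) ?P"
    by (auto simp: inj_on_def)
  have "wedge \<alpha> \<beta> (x # xs) = sum ?f ((\<lambda>I. insert 0 (Suc ` I)) ` ?P) + sum ?f ((`) Suc ` ?P)"
    unfolding wedge_def length_Cons Pow_lessThan_Suc
    by (rule sum.union_disjoint) auto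
  also have "sum ?f ((\<lambda>I. insert 0 (Suc ` I)) ` ?P) = wedge (\<lambda>u. \<alpha> (x # u)) \<beta> xs"
    unfolding wedge_def sum.reindex[OF inj(1)]
    by (rule sum.cong)
       (auto simp: shuffle_sign_insert_0 nths_Cons Compl_eq inj_image_mem_iff[OF inj_Suc])
  also have "sum ?f ((`) Suc ` ?P) = wedge (\<lambda>u. (- 1) ^ length u * \<alpha> u) (\<lambda>v. \<beta> (x # v)) xs"
    unfolding wedge_def sum.reindex[OF inj(2)]
    by (rule sum.cong)
       (auto simp: shuffle_sign_image_Suc nths_Cons length_nths_subset Compl_eq inj_image_mem_iff[OF inj_Suc])
  finally show ?thesis .
qed

section \<open>Alternation and multilinearity of exterior products\<close>

definition alternating :: "('v list \<Rightarrow> real) \<Rightarrow> bool" where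
  "alternating \<alpha> \<longleftrightarrow> (\<forall>us a vs. \<alpha> (us @ a # a # vs) = 0)"

definition multilinear :: "('v::real_vector list \<Rightarrow> real) \<Rightarrow> bool" where
  "multilinear \<alpha> \<longleftrightarrow> (\<forall>us vs. linear (\<lambda>x. \<alpha> (us @ x # vs)))"

lemma wedge_minus_left: "wedge (\<lambda>u. - \<alpha> u) \<beta> xs = - wedge \<alpha> \<beta> xs"
  by (simp add: wedge_def sum_negf)

lemma wedge_zero_left: "wedge (\<lambda>u. 0) \<beta> xs = 0" and wedge_zero_right: "wedge \<alpha> (\<lambda>u. 0) xs = 0"
  by (simp_all add: wedge_def)

lemma alternating_Cons: "alternating \<alpha> \<Longrightarrow> alternating (\<lambda>u. \<alpha> (x # u))"
  unfolding alternating_def by (simp flip: append_Cons)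

text \<open>The length-dependent factor accommodates the sign \<open>(- 1) ^ length u\<close> that
  \<open>wedge_Cons\<close> attaches to the left factor.\<close>

lemma alternating_sign: "alternating \<alpha> \<Longrightarrow> alternating (\<lambda>u. c (length u) * \<alpha> u)"
  unfolding alternating_def by simp

lemma alternating_wedge:
  assumes "alternating \<alpha>" "alternating \<beta>"
  shows "alternating (wedge \<alpha> \<beta>)"
  unfolding alternating_def
proof (intro allI)
  fix us a and vs :: "'a list"
  show "wedge \<alpha> \<beta> (us @ a # a # vs) = 0"
    using assms
  proof (induction us arbitrary: \<alpha> \<beta>)
    case Nil
    then have "\<alpha> (a # a # u) = 0" "\<beta> (a # a # u) = 0" for u
      using spec[OF Nil(1)[unfolded alternating_def], of "[]"] spec[OF Nil(2)[unfolded alternating_def], of "[]"]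
      by simp_all
    then show ?case
      \<comment> \<open>Two expansions give four terms. The terms where both copies of
        \<open>a\<close> go to the same factor vanish; the two mixed ones differ by the sign of one
        transposition and cancel.\<close>
      by (simp add: wedge_Cons wedge_zero_left wedge_zero_right wedge_minus_left)
  next
    case (Cons x us)
    show ?case
      unfolding append_Cons wedge_Cons
      using Cons.IH[OF alternating_Cons[OF Cons.prems(1)] Cons.prems(2)]
        Cons.IH[OF alternating_sign[OF Cons.prems(1)] alternating_Cons[OF Cons.prems(2)]]
      by simp
  qed
qed

lemma multilinear_Cons: "multilinear \<alpha> \<Longrightarrow> multilinear (\<lambda>u. \<alpha> (x # u))"
  unfolding multilinear_def by (simp flip: append_Cons)

lemma multilinear_sign: "multilinear \<alpha> \<Longrightarrow> multilinear (\<lambda>u. c (length u) * \<alpha> u)"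
  unfolding multilinear_def by (simp add: linear_iff algebra_simps)

lemma linear_wedge_left:
  assumes "\<And>u. linear (\<lambda>x. \<alpha> x u)" shows "linear (\<lambda>x. wedge (\<alpha> x) \<beta> vs)"
  using assms unfolding linear_iff wedge_def
  by (auto simp: algebra_simps sum.distrib sum_distrib_left)

lemma linear_wedge_right:
  assumes "\<And>u. linear (\<lambda>x. \<beta> x u)" shows "linear (\<lambda>x. wedge \<alpha> (\<beta> x) vs)"
  using assms unfolding linear_iff wedge_def
  by (auto simp: algebra_simps sum.distrib sum_distrib_left)

lemma multilinear_wedge:
  assumes "multilinear \<alpha>" "multilinear \<beta>"
  shows "multilinear (wedge \<alpha> \<beta>)"
  unfolding multilinear_def
proof (intro allI)
  fix us vs :: "'a list"
  show "linear (\<lambda>x. wedge \<alpha> \<beta> (us @ x # vs))"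
    using assms
  proof (induction us arbitrary: \<alpha> \<beta>)
    case Nil
    then have "linear (\<lambda>x. \<alpha> (x # u))" "linear (\<lambda>x. \<beta> (x # u))" for u
      using spec[OF Nil(1)[unfolded multilinear_def], of "[]"] spec[OF Nil(2)[unfolded multilinear_def], of "[]"]
      by simp_all
    then show ?case
      unfolding append_Nil wedge_Cons
      by (intro linear_compose_add linear_wedge_left linear_wedge_right)
  next
    case (Cons x us)
    show ?case
      unfolding append_Cons wedge_Cons
      by (intro linear_compose_add Cons.IH multilinear_Cons multilinear_sign Cons.prems)
  qed
qed

text \<open>No degree is recorded: the conditions range over lists of every length, in keeping with
  \<open>double_form\<close>, where the lengths of the lists select the homogeneous
  component.\<close>

definition altform :: "('v::real_vector list \<Rightarrow> real) \<Rightarrow> bool" where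
  "altform \<alpha> \<longleftrightarrow> alternating \<alpha> \<and> multilinear \<alpha>"

lemma altform_wedge: "altform \<alpha> \<Longrightarrow> altform \<beta> \<Longrightarrow> altform (wedge \<alpha> \<beta>)"
  by (simp add: altform_def alternating_wedge multilinear_wedge)

lemma altform_scale: "altform \<alpha> \<Longrightarrow> altform (\<lambda>xs. c * \<alpha> xs)"
  using alternating_sign[of \<alpha> "\<lambda>_. c"] multilinear_sign[of \<alpha> "\<lambda>_. c"] by (simp add: altform_def)

lemma altform_sum:
  assumes "\<And>i. i \<in> S \<Longrightarrow> altform (\<alpha> i)"
  shows "altform (\<lambda>xs. \<Sum>i\<in>S. \<alpha> i xs)"
  using assms unfolding altform_def alternating_def multilinear_def
  by (auto intro!: linear_compose_sum)

section \<open>Double forms alternating in each slot\<close>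

definition df_alternating :: "'v::real_vector double_form \<Rightarrow> bool" where
  "df_alternating \<omega> \<longleftrightarrow> (\<forall>ys. altform (\<lambda>xs. \<omega> xs ys)) \<and> (\<forall>xs. altform (\<omega> xs))"

text \<open>With the second list fixed, a product of double forms is a linear combination of
  exterior products in the first slot, so the results on \<open>wedge\<close> carry over to
  \<open>df_mult\<close>.\<close>

lemma df_mult_wedge_left:
  "df_mult \<omega> \<eta> xs ys = (\<Sum>J\<in>Pow {..<length ys}. shuffle_sign (length ys) J *
     wedge (\<lambda>u. \<omega> u (nths ys J)) (\<lambda>u. \<eta> u (nths ys (- J))) xs)"
  unfolding df_mult_def wedge_def sum_distrib_left
  by (subst sum.swap) (simp add: mult_ac)

lemma df_mult_wedge_right:
  "df_mult \<omega> \<eta> xs ys = (\<Sum>I\<in>Pow {..<length xs}. shuffle_sign (length xs) I *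
     wedge (\<omega> (nths xs I)) (\<eta> (nths xs (- I))) ys)"
  unfolding df_mult_def wedge_def sum_distrib_left by (simp add: mult_ac)

lemma df_alternating_mult:
  assumes "df_alternating \<omega>" "df_alternating \<eta>"
  shows "df_alternating (df_mult \<omega> \<eta>)"
proof -
  have "altform (\<lambda>xs. df_mult \<omega> \<eta> xs ys)" for ys
    unfolding df_mult_wedge_left using assms
    by (intro altform_sum altform_scale altform_wedge) (auto simp: df_alternating_def)
  moreover have "altform (df_mult \<omega> \<eta> xs)" for xs
    unfolding df_mult_wedge_right[abs_def] using assms
    by (intro altform_sum altform_scale altform_wedge) (auto simp: df_alternating_def)
  ultimately show ?thesis by (simp add: df_alternating_def)
qed

lemma df_alternating_one: "df_alternating df_one"
  unfolding df_alternating_def altform_def alternating_def multilinear_def df_one_def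
  by (simp add: linear_iff)

lemma df_alternating_power: "df_alternating \<omega> \<Longrightarrow> df_alternating (df_power \<omega> m)"
  by (induction m) (simp_all add: df_alternating_one df_alternating_mult)

lemma df_alternating_scale: "df_alternating \<omega> \<Longrightarrow> df_alternating (df_scale r \<omega>)"
  unfolding df_alternating_def df_scale_def by (auto intro: altform_scale)

lemma altform_singleton:
  assumes "linear f" shows "altform (\<lambda>xs. case xs of [x] \<Rightarrow> f x | _ \<Rightarrow> 0)"
  unfolding altform_def alternating_def multilinear_def
proof (intro conjI allI)
  fix us vs :: "'a list" and a
  show "(case us @ a # a # vs of [x] \<Rightarrow> f x | _ \<Rightarrow> 0) = 0"
    by (cases us) (auto split: list.split)
  show "linear (\<lambda>x. case us @ x # vs of [x] \<Rightarrow> f x | _ \<Rightarrow> 0)"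
  proof (cases "us = [] \<and> vs = []")
    case True then show ?thesis using assms by simp
  next
    case False
    then have "(case us @ x # vs of [x] \<Rightarrow> f x | _ \<Rightarrow> 0) = 0" for x
      by (cases us; cases vs) (auto split: list.split)
    then show ?thesis by (simp add: linear_iff)
  qed
qed

lemma df_alternating_df11:
  assumes "\<And>y. linear (\<lambda>x. B x y)" "\<And>x. linear (B x)"
  shows "df_alternating (df11 B)"
proof -
  have "(\<lambda>xs. df11 B xs ys) = (\<lambda>xs. case xs of [x] \<Rightarrow> (case ys of [y] \<Rightarrow> B x y | _ \<Rightarrow> 0) | _ \<Rightarrow> 0)" for ys
    by (auto simp: df11_def fun_eq_iff split: list.split)
  moreover have "linear (\<lambda>x. case ys of [y] \<Rightarrow> B x y | _ \<Rightarrow> 0)" for ys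
    using assms(1) by (auto split: list.split simp: linear_iff)
  moreover have "df11 B xs = (\<lambda>ys. case ys of [y] \<Rightarrow> (case xs of [x] \<Rightarrow> B x y | _ \<Rightarrow> 0) | _ \<Rightarrow> 0)" for xs
    by (auto simp: df11_def fun_eq_iff split: list.split)
  moreover have "linear (\<lambda>y. case xs of [x] \<Rightarrow> B x y | _ \<Rightarrow> 0)" for xs
    using assms(2) by (auto split: list.split simp: linear_iff)
  ultimately show ?thesis
    unfolding df_alternating_def by (auto intro!: altform_singleton)
qed

lemma altform_pair:
  assumes "\<And>y. linear (\<lambda>x. f x y)" "\<And>x. linear (f x)" "\<And>x. f x x = 0"
  shows "altform (\<lambda>xs. case xs of [x, y] \<Rightarrow> f x y | _ \<Rightarrow> 0)"
  unfolding altform_def alternating_def multilinear_def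
proof (intro conjI allI)
  fix us vs :: "'a list" and a
  let ?F = "\<lambda>xs. case xs of [x, y] \<Rightarrow> f x y | _ \<Rightarrow> 0"
  show "?F (us @ a # a # vs) = 0"
    using assms(3) by (cases us) (auto split: list.split)
  consider y where "us = []" "vs = [y]" | x where "us = [x]" "vs = []"
    | "\<And>x. length (us @ x # vs) \<noteq> 2"
    by (cases us; cases vs) (auto simp: length_Suc_conv numeral_2_eq_2)
  then show "linear (\<lambda>x. ?F (us @ x # vs))"
  proof cases
    case 3
    then have "?F (us @ x # vs) = 0" for x
      using 3[of x] by (auto split: list.split dest!: arg_cong[where f=length])
    then show ?thesis by (simp add: linear_iff)
  qed (use assms in auto)
qed

lemma df_alternating_df22:
  assumes "\<And>b c d. linear (\<lambda>a. R a b c d)" "\<And>a c d. linear (\<lambda>b. R a b c d)"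
    and "\<And>a b d. linear (\<lambda>c. R a b c d)" "\<And>a b c. linear (\<lambda>d. R a b c d)"
    and "\<And>a c d. R a a c d = 0" "\<And>a b c. R a b c c = 0"
  shows "df_alternating (df22 R)"
proof -
  have "(\<lambda>xs. df22 R xs ys) =
      (\<lambda>xs. case xs of [a, b] \<Rightarrow> (case ys of [c, d] \<Rightarrow> R a b c d | _ \<Rightarrow> 0) | _ \<Rightarrow> 0)" for ys
    by (auto simp: df22_def fun_eq_iff split: list.split)
  moreover have "altform (\<lambda>xs. case xs of [a, b] \<Rightarrow> (case ys of [c, d] \<Rightarrow> R a b c d | _ \<Rightarrow> 0) | _ \<Rightarrow> 0)" for ys
    using assms by (intro altform_pair) (auto split: list.split simp: linear_iff)
  moreover have "df22 R xs =
      (\<lambda>ys. case ys of [c, d] \<Rightarrow> (case xs of [a, b] \<Rightarrow> R a b c d | _ \<Rightarrow> 0) | _ \<Rightarrow> 0)" for xs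
    by (auto simp: df22_def fun_eq_iff split: list.split)
  moreover have "altform (\<lambda>ys. case ys of [c, d] \<Rightarrow> (case xs of [a, b] \<Rightarrow> R a b c d | _ \<Rightarrow> 0) | _ \<Rightarrow> 0)" for xs
    using assms by (intro altform_pair) (auto split: list.split simp: linear_iff)
  ultimately show ?thesis
    unfolding df_alternating_def by simp
qed

section \<open>Forms of top degree\<close>

lemma altform_add:
  assumes "altform \<alpha>" shows "\<alpha> (us @ (a + b) # vs) = \<alpha> (us @ a # vs) + \<alpha> (us @ b # vs)"
  using assms unfolding altform_def multilinear_def linear_iff by simp

lemma altform_swap_adjacent:
  assumes "altform \<alpha>"
  shows "\<alpha> (us @ a # b # vs) = - \<alpha> (us @ b # a # vs)"
proof -
  have z: "\<alpha> (us @ c # c # vs) = 0" for c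
    using assms by (simp add: altform_def alternating_def)
  have "0 = \<alpha> (us @ (a + b) # (a + b) # vs)"
    by (simp add: z)
  also have "\<dots> = \<alpha> ((us @ [a]) @ (a + b) # vs) + \<alpha> ((us @ [b]) @ (a + b) # vs)"
    by (simp add: altform_add[OF assms])
  also have "\<dots> = \<alpha> (us @ a # b # vs) + \<alpha> (us @ b # a # vs)"
    unfolding altform_add[OF assms] by (simp add: z)
  finally show ?thesis by simp
qed

text \<open>\<open>alternating\<close> speaks of adjacent entries only; adjacent swaps move the
  first \<open>a\<close> along \<open>ws\<close> until it meets the second.\<close>

lemma altform_repeated:
  assumes "altform \<alpha>" shows "\<alpha> (us @ a # ws @ a # vs) = 0"
proof (induction ws arbitrary: us)
  case Nil
  then show ?case using assms by (simp add: altform_def alternating_def)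
next
  case (Cons w ws)
  have "\<alpha> (us @ a # w # ws @ a # vs) = - \<alpha> (us @ w # a # ws @ a # vs)"
    by (rule altform_swap_adjacent[OF assms])
  then show ?case using Cons[of "us @ [w]"] by simp
qed

lemma altform_map_linear:
  assumes "altform \<alpha>" "distinct es" "i \<in> set es"
  shows "linear (\<lambda>y. \<alpha> (map (x(i := y)) es))"
proof -
  obtain us vs where es: "es = us @ i # vs"
    using assms(3) by (meson split_list)
  then have "map (x(i := y)) es = map x us @ y # map x vs" for y
    using assms(2) by simp
  then show ?thesis
    using assms(1) by (simp add: altform_def multilinear_def)
qed

lemma altform_map_repeated:
  assumes "altform \<alpha>" "i \<in> set es" "j \<in> set es" "i \<noteq> j" "x i = x j"
  shows "\<alpha> (map x es) = 0"
proof -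
  obtain us vs where es: "es = us @ i # vs"
    using assms(2) by (meson split_list)
  then consider "j \<in> set us" | "j \<in> set vs" using assms by auto
  then obtain a b c where "map x es = a @ x i # b @ x i # c"
  proof cases
    case 1
    then obtain p q where "us = p @ j # q" by (meson split_list)
    with es assms(5) that show ?thesis by simp
  next
    case 2
    then obtain p q where "vs = p @ j # q" by (meson split_list)
    with es assms(5) that show ?thesis by simp
  qed
  then show ?thesis by (simp add: altform_repeated[OF assms(1)])
qed

text \<open>It suffices to treat factors that generate all matrices: a matrix with a zero row,
  diagonal matrices, transpositions of columns and one elementary row addition. The family
  \<open>x\<close> is generalised because in a product the left factor acts on the family already
  combined by the right factor.\<close>

lemma alternating_multilinear_det:
  fixes F :: "('n::finite \<Rightarrow> 'v::real_vector) \<Rightarrow> real"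
  assumes lin: "\<And>i x. linear (\<lambda>y. F (x(i := y)))"
    and alt: "\<And>i j x. i \<noteq> j \<Longrightarrow> x i = x j \<Longrightarrow> F x = 0"
  shows "F (\<lambda>k. \<Sum>j\<in>UNIV. A $ k $ j *\<^sub>R x j) = det A * F x"
proof -
  have add: "F (x(i := a + b)) = F (x(i := a)) + F (x(i := b))" for x i a b
    using linear_add[OF lin] .
  have scale: "F (x(i := c *\<^sub>R x i)) = c * F x" for x i c
    using linear_scale[OF lin, of x i c "x i"] by simp
  have zero: "F x = 0" if "x i = 0" for x i
    using linear_0[OF lin, of x i] that by (metis fun_upd_triv)
  have "\<forall>x. F (\<lambda>k. \<Sum>j\<in>UNIV. A $ k $ j *\<^sub>R x j) = det A * F x"
  proof (induction A rule: induct_matrix_elementary_alt)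
    case (1 A B)
    have "(\<Sum>j\<in>UNIV. (A ** B) $ k $ j *\<^sub>R x j) = (\<Sum>l\<in>UNIV. A $ k $ l *\<^sub>R (\<Sum>j\<in>UNIV. B $ l $ j *\<^sub>R x j))"
      for k and x :: "'n \<Rightarrow> 'v"
    proof -
      have "(\<Sum>j\<in>UNIV. (A ** B) $ k $ j *\<^sub>R x j)
          = (\<Sum>j\<in>UNIV. \<Sum>l\<in>UNIV. A $ k $ l *\<^sub>R B $ l $ j *\<^sub>R x j)"
        by (simp add: matrix_matrix_mult_def scaleR_sum_left)
      also have "\<dots> = (\<Sum>l\<in>UNIV. \<Sum>j\<in>UNIV. A $ k $ l *\<^sub>R B $ l $ j *\<^sub>R x j)"
        by (rule sum.swap)
      finally show ?thesis by (simp only: scaleR_sum_right)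
    qed
    then show ?case
      using 1 by (simp add: det_mul)
  next
    case (2 A i)
    have "A $ i $ j = 0" for j
      using 2 by (simp add: row_def vec_eq_iff)
    then show ?case
      using 2 by (simp add: zero[of _ i] det_zero_row)
  next
    case (3 A)
    have s: "(\<Sum>j\<in>UNIV. A $ k $ j *\<^sub>R x j) = A $ k $ k *\<^sub>R x k"
      for x :: "'n \<Rightarrow> 'v" and k
      using 3 by (subst sum.remove[of _ k]) auto
    \<comment> \<open>Entries are rescaled one index at a time; \<open>S\<close> collects the
      indices already treated, and \<open>S = UNIV\<close> is the diagonal case.\<close>
    have "F (\<lambda>k. if k \<in> S then A $ k $ k *\<^sub>R x k else x k) = (\<Prod>k\<in>S. A $ k $ k) * F x"
      if "finite S" for S x
      using that
    proof (induction S rule: finite_induct)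
      case (insert i S)
      let ?z = "\<lambda>k. if k \<in> S then A $ k $ k *\<^sub>R x k else x k"
      have "(\<lambda>k. if k \<in> insert i S then A $ k $ k *\<^sub>R x k else x k) = ?z(i := A $ i $ i *\<^sub>R ?z i)"
        using insert by auto
      then show ?case using scale[of ?z i "A $ i $ i"] insert by simp
    qed auto
    from this[of UNIV] show ?case
      using 3 by (simp add: s det_diagonal)
  next
    case (4 m n)
    have eq: "(\<Sum>j\<in>UNIV. (\<chi> i j. mat 1 $ i $ Transposition.transpose m n j) $ k $ j *\<^sub>R x j)
        = (x(m := x n, n := x m)) k" for x :: "'n \<Rightarrow> 'v" and k
    proof -
      have "(\<Sum>j\<in>UNIV. (\<chi> i j. mat 1 $ i $ Transposition.transpose m n j) $ k $ j *\<^sub>R x j)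
          = (\<Sum>j\<in>UNIV. if j = Transposition.transpose m n k then x j else 0)"
        by (rule sum.cong) (auto simp: mat_def)
      then show ?thesis using 4 by (auto simp: Transposition.transpose_def)
    qed
    have "F (x(m := x n, n := x m)) = - F x" for x
    proof -
      \<comment> \<open>With all other entries frozen, \<open>F\<close> is a bilinear function of
        entries \<open>m\<close> and \<open>n\<close> that vanishes on the diagonal; polarisation
        makes it antisymmetric.\<close>
      define G where "G a b = F (x(m := a, n := b))" for a b
      have Gr: "G a (b + c) = G a b + G a c" for a b c
        unfolding G_def by (rule add)
      have Gl: "G (a + b) c = G a c + G b c" for a b c
        unfolding G_def using add[of "x(n := c)"] 4 by (simp add: fun_upd_twist)
      have G0: "G a a = 0" for a
        unfolding G_def using 4 by (intro alt[of m n]) auto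
      have "G (x m + x n) (x m + x n) = G (x m) (x n) + G (x n) (x m)"
        unfolding Gr Gl by (simp add: G0)
      then have "G (x m) (x n) + G (x n) (x m) = 0" by (simp only: G0)
      then show ?thesis unfolding G_def by simp
    qed
    moreover have "det (\<chi> i j. (mat 1 :: real^'n^'n) $ i $ Transposition.transpose m n j) = - 1"
      using 4 by (subst det_permute_columns) (auto simp: permutes_swap_id sign_swap_id)
    ultimately show ?case unfolding eq by (simp del: fun_upd_apply)
  next
    case (5 m n)
    have eq: "(\<Sum>j\<in>UNIV. (\<chi> i j. of_bool (i = m \<and> j = n \<or> i = j)) $ k $ j *\<^sub>R x j)
        = (x(m := x m + x n)) k" for x :: "'n \<Rightarrow> 'v" and k
    proof -
      have "(\<Sum>j\<in>UNIV. (\<chi> i j. of_bool (i = m \<and> j = n \<or> i = j)) $ k $ j *\<^sub>R x j)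
          = (\<Sum>j\<in>UNIV. (if j = k then x j else 0) + (if j = n then (if k = m then x j else 0) else 0))"
        using 5 by (intro sum.cong) auto
      also have "\<dots> = (x(m := x m + x n)) k"
        by (simp add: sum.distrib)
      finally show ?thesis .
    qed
    have "F (x(m := x m + x n)) = F x" for x
      using add[of x m "x m" "x n"] alt[of m n "x(m := x n)"] 5 by simp
    moreover have "det (\<chi> i j. of_bool (i = m \<and> j = n \<or> i = j) :: real^'n^'n) = 1"
    proof -
      have "(\<chi> i j. of_bool (i = m \<and> j = n \<or> i = j) :: real^'n^'n)
          = (\<chi> k. if k = m then row m (mat 1) + 1 *s row n (mat 1) else row k (mat 1))"
        using 5 by (auto simp: vec_eq_iff row_def mat_def)
      then show ?thesis using det_row_operation[OF 5, of "mat 1" 1] by simp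
    qed
    ultimately show ?case unfolding eq by (simp del: fun_upd_apply)
  qed
  then show ?thesis by blast
qed

text \<open>The list \<open>es\<close> enumerates the index type, which turns families indexed by
  \<open>'n\<close> into argument lists of length n.\<close>

lemma altform_det:
  fixes x :: "'n::finite \<Rightarrow> 'v::real_vector"
  assumes "altform \<alpha>" "distinct es" "set es = UNIV"
  shows "\<alpha> (map (\<lambda>k. \<Sum>j\<in>UNIV. A $ k $ j *\<^sub>R x j) es) = det A * \<alpha> (map x es)"
  using assms altform_map_linear[OF assms(1,2)] altform_map_repeated[OF assms(1), of _ es]
  by (intro alternating_multilinear_det[where F="\<lambda>x. \<alpha> (map x es)"]) auto

text \<open>Each slot contributes one determinant. The square forgets its sign, so the orientation
  of the basis has no influence.\<close>

lemma df_alternating_det: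
  fixes x :: "'n::finite \<Rightarrow> 'v::real_vector"
  assumes "df_alternating \<omega>" "distinct es" "set es = UNIV"
  shows "\<omega> (map (\<lambda>k. \<Sum>j\<in>UNIV. A $ k $ j *\<^sub>R x j) es) (map (\<lambda>k. \<Sum>j\<in>UNIV. A $ k $ j *\<^sub>R x j) es)
    = (det A)\<^sup>2 * \<omega> (map x es) (map x es)"
  using altform_det[of "\<lambda>xs. \<omega> xs (map (\<lambda>k. \<Sum>j\<in>UNIV. A $ k $ j *\<^sub>R x j) es)", OF _ assms(2,3)]
    altform_det[of "\<omega> (map x es)", OF _ assms(2,3)] assms(1)
  by (simp add: df_alternating_def power2_eq_square)

section \<open>Smooth functions and partial derivatives\<close>

lemma pderiv_at_has_derivative:
  "(f has_derivative D) (at x) \<Longrightarrow> pderiv_at i f x = D (axis i 1)"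
  by (simp add: pderiv_at_def frechet_derivative_at[symmetric])

lemma has_derivative_pderiv:
  assumes "f differentiable (at x)"
  shows "(f has_derivative (\<lambda>v. \<Sum>i\<in>UNIV. v $ i * pderiv_at i f x)) (at x)"
proof -
  define D where "D = frechet_derivative f (at x)"
  have D: "(f has_derivative D) (at x)"
    using assms frechet_derivative_works D_def by auto
  then have "linear D" by (simp add: has_derivative_linear)
  have "D v = (\<Sum>i\<in>UNIV. v $ i * pderiv_at i f x)" for v
  proof -
    have "D v = D (\<Sum>i\<in>UNIV. v $ i *\<^sub>R axis i 1)"
      using basis_expansion[of v] by (simp add: scalar_mult_eq_scaleR)
    then show ?thesis
      by (simp add: linear_sum[OF \<open>linear D\<close>] linear_scale[OF \<open>linear D\<close>] pderiv_at_has_derivative[OF D])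
  qed
  then have "D = (\<lambda>v. \<Sum>i\<in>UNIV. v $ i * pderiv_at i f x)" by auto
  with D show ?thesis by simp
qed

lemma pderiv_at_const: "pderiv_at i (\<lambda>x. c) x = 0"
  by (rule pderiv_at_has_derivative[of _ "\<lambda>_. 0"]) simp

lemma pderiv_at_add:
  assumes "f differentiable (at x)" "g differentiable (at x)"
  shows "pderiv_at i (\<lambda>x. f x + g x) x = pderiv_at i f x + pderiv_at i g x"
  using assms unfolding pderiv_at_def
  by (subst frechet_derivative_at[symmetric, OF has_derivative_add]) (auto simp: frechet_derivative_works[symmetric])

lemma pderiv_at_mult:
  assumes "f differentiable (at x)" "g differentiable (at x)"
  shows "pderiv_at i (\<lambda>x. f x * g x) x = f x * pderiv_at i g x + pderiv_at i f x * g x"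
  using assms unfolding pderiv_at_def
  by (subst frechet_derivative_at[symmetric, OF has_derivative_mult]) (auto simp: frechet_derivative_works[symmetric])

lemma pderiv_at_sum:
  assumes "\<And>j. j \<in> J \<Longrightarrow> f j differentiable (at x)"
  shows "pderiv_at i (\<lambda>x. \<Sum>j\<in>J. f j x) x = (\<Sum>j\<in>J. pderiv_at i (f j) x)"
proof -
  have "((\<lambda>x. \<Sum>j\<in>J. f j x) has_derivative (\<lambda>v. \<Sum>j\<in>J. frechet_derivative (f j) (at x) v)) (at x)"
    using assms by (intro has_derivative_sum) (auto simp: frechet_derivative_works[symmetric])
  from pderiv_at_has_derivative[OF this] show ?thesis by (simp add: pderiv_at_def)
qed

lemma pderiv_at_inverse:
  assumes "f differentiable (at x)" "f x \<noteq> 0"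
  shows "pderiv_at i (\<lambda>x. inverse (f x)) x = - (inverse (f x) * pderiv_at i f x * inverse (f x))"
proof -
  have "((\<lambda>x. inverse (f x)) has_derivative
      (\<lambda>h. - (inverse (f x) * frechet_derivative f (at x) h * inverse (f x)))) (at x)"
    using assms by (intro Deriv.has_derivative_inverse) (auto simp: frechet_derivative_works[symmetric])
  from pderiv_at_has_derivative[OF this] show ?thesis by (simp add: pderiv_at_def)
qed

lemma has_derivative_cong_open:
  assumes "open S" "x \<in> S" "\<And>y. y \<in> S \<Longrightarrow> f y = g y"
  shows "(f has_derivative D) (at x) \<longleftrightarrow> (g has_derivative D) (at x)"
  using has_derivative_transform_within_open[OF _ assms(1,2)] assms(3) by metis

text \<open>\<open>frechet_derivative\<close> is a choice from the relation
  \<open>has_derivative\<close>. The two functions have the same derivatives in the sense of that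
  relation, so the same choice is made even where neither is differentiable.\<close>

lemma pderiv_at_cong_open:
  assumes "open S" "x \<in> S" "\<And>y. y \<in> S \<Longrightarrow> f y = g y"
  shows "pderiv_at i f x = pderiv_at i g x"
proof -
  have "(f has_derivative D) (at x) \<longleftrightarrow> (g has_derivative D) (at x)" for D
    using assms by (rule has_derivative_cong_open)
  then show ?thesis by (simp add: pderiv_at_def frechet_derivative_def)
qed

lemma differentiable_cong_open:
  assumes "open S" "x \<in> S" "\<And>y. y \<in> S \<Longrightarrow> f y = g y"
  shows "f differentiable (at x) \<longleftrightarrow> g differentiable (at x)"
  unfolding differentiable_def by (intro arg_cong[where f=Ex] ext has_derivative_cong_open[OF assms])

text \<open>The inner map is known through its components, as in \<open>smooth_manifold\<close>, so
  its total derivative is assembled from theirs before the chain rule is applied.\<close>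

lemma differentiable_chain_pderiv:
  fixes \<phi> :: "real^'n::finite \<Rightarrow> real^'m::finite" and f :: "real^'m \<Rightarrow> real"
  assumes "\<And>p. (\<lambda>y. \<phi> y $ p) differentiable (at x)" "f differentiable (at (\<phi> x))"
  shows "(\<lambda>y. f (\<phi> y)) differentiable (at x)"
    and "pderiv_at i (\<lambda>y. f (\<phi> y)) x
      = (\<Sum>p\<in>UNIV. pderiv_at p f (\<phi> x) * pderiv_at i (\<lambda>y. \<phi> y $ p) x)"
proof -
  define D where "D v = (\<chi> p. frechet_derivative (\<lambda>y. \<phi> y $ p) (at x) v)" for v
  have D: "(\<phi> has_derivative D) (at x)"
    using assms(1) unfolding has_derivative_componentwise_within[of \<phi> D] Basis_vec_def D_def
    by (auto simp: inner_axis frechet_derivative_works[symmetric])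
  note d = has_derivative_compose[OF D has_derivative_pderiv[OF assms(2)]]
  show "(\<lambda>y. f (\<phi> y)) differentiable (at x)"
    using d by (auto simp: differentiable_def)
  show "pderiv_at i (\<lambda>y. f (\<phi> y)) x
      = (\<Sum>p\<in>UNIV. pderiv_at p f (\<phi> x) * pderiv_at i (\<lambda>y. \<phi> y $ p) x)"
    using pderiv_at_has_derivative[OF d, of i] by (simp add: D_def pderiv_at_def mult.commute)
qed

section \<open>Algebraic closure properties of smooth functions\<close>

lemma Ck_on_cong:
  assumes "open S" "\<And>x. x \<in> S \<Longrightarrow> f x = g x"
  shows "Ck_on m S f \<longleftrightarrow> Ck_on m S g"
  using assms(2)
proof (induction m arbitrary: f g)
  case 0
  then show ?case by (simp cong: continuous_on_cong)
next
  case (Suc m)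
  have "Ck_on m S (pderiv_at i f) \<longleftrightarrow> Ck_on m S (pderiv_at i g)" for i
    by (rule Suc.IH) (rule pderiv_at_cong_open[OF assms(1) _ Suc.prems])
  moreover have "f differentiable (at x) \<longleftrightarrow> g differentiable (at x)" if "x \<in> S" for x
    by (rule differentiable_cong_open[OF assms(1) that Suc.prems])
  ultimately show ?case by simp
qed

lemma Ck_on_Suc: "Ck_on (Suc m) S f \<Longrightarrow> Ck_on m S f"
proof (induction m arbitrary: f)
  case 0
  then show ?case
    by (auto intro!: continuous_at_imp_continuous_on differentiable_imp_continuous_within)
next
  case (Suc m)
  then show ?case by (metis Ck_on.simps(2))
qed

lemma Ck_on_const: "Ck_on m S (\<lambda>x. c)"
proof (induction m arbitrary: c)
  case (Suc m)
  have "pderiv_at i (\<lambda>x. c) = (\<lambda>x. 0)" for i :: 'a by (simp add: fun_eq_iff pderiv_at_const)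
  then show ?case using Suc by simp
qed simp

lemma Ck_on_add:
  assumes "open S"
  shows "Ck_on m S f \<Longrightarrow> Ck_on m S g \<Longrightarrow> Ck_on m S (\<lambda>x. f x + g x)"
proof (induction m arbitrary: f g)
  case (Suc m)
  have "Ck_on m S (pderiv_at i (\<lambda>x. f x + g x)) \<longleftrightarrow> Ck_on m S (\<lambda>x. pderiv_at i f x + pderiv_at i g x)" for i
    using Suc.prems by (intro Ck_on_cong[OF assms] pderiv_at_add) auto
  with Suc show ?case by simp
qed (simp add: continuous_on_add)

lemma Ck_on_mult:
  assumes "open S"
  shows "Ck_on m S f \<Longrightarrow> Ck_on m S g \<Longrightarrow> Ck_on m S (\<lambda>x. f x * g x)"
proof (induction m arbitrary: f g)
  case (Suc m)
  have "Ck_on m S (pderiv_at i (\<lambda>x. f x * g x)) \<longleftrightarrow>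
      Ck_on m S (\<lambda>x. f x * pderiv_at i g x + pderiv_at i f x * g x)" for i
    using Suc.prems by (intro Ck_on_cong[OF assms] pderiv_at_mult) auto
  moreover have "Ck_on m S (\<lambda>x. f x * pderiv_at i g x + pderiv_at i f x * g x)" for i
    using Suc.prems Ck_on_Suc[OF Suc.prems(1)] Ck_on_Suc[OF Suc.prems(2)]
    by (intro Ck_on_add[OF assms] Suc.IH) auto
  ultimately show ?case using Suc.prems by simp
qed (simp add: continuous_on_mult)

lemma Ck_on_inverse:
  assumes "open S" "\<And>x. x \<in> S \<Longrightarrow> f x \<noteq> 0"
  shows "Ck_on m S f \<Longrightarrow> Ck_on m S (\<lambda>x. inverse (f x))"
proof (induction m)
  case 0
  then show ?case using assms(2) by (simp add: continuous_on_inverse)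
next
  case (Suc m)
  have "Ck_on m S (pderiv_at i (\<lambda>x. inverse (f x))) \<longleftrightarrow>
      Ck_on m S (\<lambda>x. (- 1) * (inverse (f x) * pderiv_at i f x * inverse (f x)))" for i
    using Suc.prems assms(2) by (intro Ck_on_cong[OF assms(1)]) (simp add: pderiv_at_inverse)
  \<comment> \<open>The derivative of the inverse again contains the inverse, but only with
    regularity \<open>m\<close>, which the induction hypothesis supplies.\<close>
  moreover have "Ck_on m S (\<lambda>x. (- 1) * (inverse (f x) * pderiv_at i f x * inverse (f x)))" for i
    using Suc.prems Suc.IH[OF Ck_on_Suc[OF Suc.prems]]
    by (intro Ck_on_mult[OF assms(1)] Ck_on_const) auto
  ultimately show ?case using Suc.prems assms(2) by (auto intro: differentiable_inverse)
qed

lemma smooth_on_const: "smooth_on S (\<lambda>x. c)"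
  by (simp add: smooth_on_def Ck_on_const)

lemma smooth_on_add: "open S \<Longrightarrow> smooth_on S f \<Longrightarrow> smooth_on S g \<Longrightarrow> smooth_on S (\<lambda>x. f x + g x)"
  by (simp add: smooth_on_def Ck_on_add)

lemma smooth_on_mult: "open S \<Longrightarrow> smooth_on S f \<Longrightarrow> smooth_on S g \<Longrightarrow> smooth_on S (\<lambda>x. f x * g x)"
  by (simp add: smooth_on_def Ck_on_mult)

lemma smooth_on_inverse:
  "open S \<Longrightarrow> smooth_on S f \<Longrightarrow> (\<And>x. x \<in> S \<Longrightarrow> f x \<noteq> 0) \<Longrightarrow> smooth_on S (\<lambda>x. inverse (f x))"
  by (simp add: smooth_on_def Ck_on_inverse)

lemma smooth_on_minus: "open S \<Longrightarrow> smooth_on S f \<Longrightarrow> smooth_on S (\<lambda>x. - f x)"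
  using smooth_on_mult[OF _ smooth_on_const[of S "- 1"], of f] by simp

lemma smooth_on_diff: "open S \<Longrightarrow> smooth_on S f \<Longrightarrow> smooth_on S g \<Longrightarrow> smooth_on S (\<lambda>x. f x - g x)"
  using smooth_on_add[OF _ _ smooth_on_minus, of S f g] by simp

lemma smooth_on_divide:
  "open S \<Longrightarrow> smooth_on S f \<Longrightarrow> smooth_on S g \<Longrightarrow> (\<And>x. x \<in> S \<Longrightarrow> g x \<noteq> 0) \<Longrightarrow>
    smooth_on S (\<lambda>x. f x / g x)"
  by (simp add: divide_inverse smooth_on_mult smooth_on_inverse)

lemma smooth_on_sum:
  assumes "open S" "\<And>i. i \<in> J \<Longrightarrow> smooth_on S (f i)"
  shows "smooth_on S (\<lambda>x. \<Sum>i\<in>J. f i x)"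
  using assms(2) by (induction J rule: infinite_finite_induct) (auto intro!: smooth_on_const smooth_on_add assms(1))

lemma smooth_on_prod:
  assumes "open S" "\<And>i. i \<in> J \<Longrightarrow> smooth_on S (f i)"
  shows "smooth_on S (\<lambda>x. \<Prod>i\<in>J. f i x)"
  using assms(2) by (induction J rule: infinite_finite_induct) (auto intro!: smooth_on_const smooth_on_mult assms(1))

lemma smooth_on_cong:
  "open S \<Longrightarrow> (\<And>x. x \<in> S \<Longrightarrow> f x = g x) \<Longrightarrow> smooth_on S f \<longleftrightarrow> smooth_on S g"
  unfolding smooth_on_def by (metis Ck_on_cong)

lemma smooth_on_pderiv_at: "smooth_on S f \<Longrightarrow> smooth_on S (pderiv_at i f)"
  unfolding smooth_on_def by (metis Ck_on.simps(2))

lemma smooth_on_differentiable: "smooth_on S f \<Longrightarrow> x \<in> S \<Longrightarrow> f differentiable (at x)"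
  unfolding smooth_on_def by (metis Ck_on.simps(2))

lemma smooth_on_det:
  fixes M :: "real^'m::finite \<Rightarrow> real^'n::finite^'n"
  assumes "open S" "\<And>i j. smooth_on S (\<lambda>x. M x $ i $ j)"
  shows "smooth_on S (\<lambda>x. det (M x))"
  unfolding det_def using assms
  by (intro smooth_on_sum smooth_on_mult smooth_on_const smooth_on_prod)

lemma matrix_mult_matrix_inv:
  fixes A :: "real^'n::finite^'n"
  assumes "det A \<noteq> 0" shows "A ** matrix_inv A = mat 1"
proof -
  have "\<exists>A'. A ** A' = mat 1 \<and> A' ** A = mat 1"
    using assms by (simp add: invertible_det_nz[symmetric] invertible_def)
  from someI_ex[OF this] show ?thesis by (simp add: matrix_inv_def)
qed

text \<open>Cramer's rule: it displays the entries of the inverse as quotients of determinants in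
  the original entries, from which smoothness follows.\<close>

lemma matrix_inv_component:
  fixes A :: "real^'n::finite^'n"
  assumes "det A \<noteq> 0"
  shows "matrix_inv A $ k $ l = det (\<chi> i j. if j = k then axis l 1 $ i else A $ i $ j) / det A"
proof -
  have "A *v (matrix_inv A *v axis l 1) = axis l 1"
    using assms by (simp add: matrix_vector_mul_assoc matrix_mult_matrix_inv)
  then have "matrix_inv A *v axis l 1 = (\<chi> k. det (\<chi> i j. if j = k then axis l 1 $ i else A $ i $ j) / det A)"
    using cramer[OF assms] by blast
  then show ?thesis
    by (simp add: vec_eq_iff matrix_vector_mul_component column_def matrix_vector_mult_basis)
qed

lemma smooth_on_matrix_inv:
  fixes M :: "real^'m::finite \<Rightarrow> real^'n::finite^'n"
  assumes "open S" "\<And>i j. smooth_on S (\<lambda>x. M x $ i $ j)" "\<And>x. x \<in> S \<Longrightarrow> det (M x) \<noteq> 0"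
  shows "smooth_on S (\<lambda>x. matrix_inv (M x) $ k $ l)"
proof -
  have "smooth_on S (\<lambda>x. det (\<chi> i j. if j = k then axis l 1 $ i else M x $ i $ j) / det (M x))"
  proof (intro smooth_on_divide smooth_on_det assms)
    fix i j
    show "smooth_on S (\<lambda>x. (\<chi> i j. if j = k then axis l 1 $ i else M x $ i $ j) $ i $ j)"
      using assms by (cases "j = k") (simp_all add: smooth_on_const)
  qed
  then show ?thesis
    using assms by (subst smooth_on_cong[OF assms(1) matrix_inv_component]) auto
qed

section \<open>Symmetry of second partial derivatives\<close>

lemma DERIV_line:
  fixes f :: "real^'n::finite \<Rightarrow> real"
  assumes "f differentiable (at (y + s *\<^sub>R axis i 1))"
  shows "((\<lambda>s. f (y + s *\<^sub>R axis i 1)) has_real_derivative pderiv_at i f (y + s *\<^sub>R axis i 1)) (at s)"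
proof -
  let ?D = "frechet_derivative f (at (y + s *\<^sub>R axis i 1))"
  have D: "(f has_derivative ?D) (at (y + s *\<^sub>R axis i 1))"
    using assms frechet_derivative_works by auto
  have "((\<lambda>s. y + s *\<^sub>R axis i 1) has_derivative (\<lambda>h. h *\<^sub>R axis i 1)) (at s)"
    by (auto intro!: derivative_eq_intros)
  from has_derivative_compose[OF this D]
  have "((\<lambda>s. f (y + s *\<^sub>R axis i 1)) has_derivative (\<lambda>h. ?D (h *\<^sub>R axis i 1))) (at s)" .
  moreover have "(\<lambda>h. ?D (h *\<^sub>R axis i 1)) = (*) (pderiv_at i f (y + s *\<^sub>R axis i 1))"
    using has_derivative_linear[OF D] by (simp add: fun_eq_iff linear_scale pderiv_at_def)
  ultimately show ?thesis by (simp add: has_field_derivative_def)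
qed

text \<open>The mean value theorem is applied along axis \<open>i\<close> to the increment of
  \<open>f\<close> in direction \<open>j\<close>, then along axis \<open>j\<close> to the resulting
  increment of \<open>pderiv_at i f\<close>. The bound \<open>2 * t < r\<close> keeps all points
  involved inside the ball.\<close>

lemma second_difference_mean_value:
  fixes f :: "real^'n::finite \<Rightarrow> real"
  assumes sub: "ball x r \<subseteq> S" and t: "0 < t" "2 * t < r"
    and f: "\<And>y. y \<in> S \<Longrightarrow> f differentiable (at y)"
    and fi: "\<And>y. y \<in> S \<Longrightarrow> pderiv_at i f differentiable (at y)"
  shows "\<exists>\<xi> \<eta>. 0 < \<xi> \<and> \<xi> < t \<and> 0 < \<eta> \<and> \<eta> < t \<and>
    f (x + t *\<^sub>R axis i 1 + t *\<^sub>R axis j 1) - f (x + t *\<^sub>R axis i 1) - f (x + t *\<^sub>R axis j 1) + f x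
    = t * t * pderiv_at j (pderiv_at i f) (x + \<xi> *\<^sub>R axis i 1 + \<eta> *\<^sub>R axis j 1)"
proof -
  let ?u = "axis i 1 :: real^'n" and ?v = "axis j 1 :: real^'n"
  have in_S: "x + a *\<^sub>R ?u + b *\<^sub>R ?v \<in> S" if "0 \<le> a" "a \<le> t" "0 \<le> b" "b \<le> t" for a b
  proof -
    have "norm (a *\<^sub>R ?u + b *\<^sub>R ?v) \<le> a + b"
      using that norm_triangle_ineq[of "a *\<^sub>R ?u" "b *\<^sub>R ?v"] by (simp add: norm_axis_1)
    then have "x + (a *\<^sub>R ?u + b *\<^sub>R ?v) \<in> ball x r"
      using that t by (simp only: mem_ball dist_norm norm_minus_commute[of x] add_diff_cancel_left')
    with sub show ?thesis by (auto simp: add.assoc)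
  qed
  have sw: "x + a *\<^sub>R ?u + b *\<^sub>R ?v = (x + b *\<^sub>R ?v) + a *\<^sub>R ?u" for a b by simp
  have d1: "((\<lambda>s. f (x + s *\<^sub>R ?u + b *\<^sub>R ?v)) has_real_derivative
      pderiv_at i f (x + a *\<^sub>R ?u + b *\<^sub>R ?v)) (at a)"
    if "0 \<le> a" "a \<le> t" "0 \<le> b" "b \<le> t" for a b
    using DERIV_line[of f "x + b *\<^sub>R ?v" a i] f[OF in_S[OF that]] unfolding sw by simp
  \<comment> \<open>The summand with factor 0 is kept so that \<open>d1\<close> applies to both
    terms, with \<open>b = t\<close> and \<open>b = 0\<close>.\<close>
  have "\<exists>z>0. z < t \<and>
      (\<lambda>s. f (x + s *\<^sub>R ?u + t *\<^sub>R ?v) - f (x + s *\<^sub>R ?u + 0 *\<^sub>R ?v)) t -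
      (\<lambda>s. f (x + s *\<^sub>R ?u + t *\<^sub>R ?v) - f (x + s *\<^sub>R ?u + 0 *\<^sub>R ?v)) 0 =
      (t - 0) * (pderiv_at i f (x + z *\<^sub>R ?u + t *\<^sub>R ?v) - pderiv_at i f (x + z *\<^sub>R ?u + 0 *\<^sub>R ?v))"
    using t by (intro MVT2 DERIV_diff d1) auto
  then obtain \<xi> where \<xi>: "0 < \<xi>" "\<xi> < t"
    "f (x + t *\<^sub>R ?u + t *\<^sub>R ?v) - f (x + t *\<^sub>R ?u) - (f (x + t *\<^sub>R ?v) - f x)
      = t * (pderiv_at i f (x + \<xi> *\<^sub>R ?u + t *\<^sub>R ?v) - pderiv_at i f (x + \<xi> *\<^sub>R ?u))"
    by auto
  have "\<exists>z>0. z < t \<and>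
      pderiv_at i f (x + \<xi> *\<^sub>R ?u + t *\<^sub>R ?v) - pderiv_at i f (x + \<xi> *\<^sub>R ?u + 0 *\<^sub>R ?v)
      = (t - 0) * pderiv_at j (pderiv_at i f) (x + \<xi> *\<^sub>R ?u + z *\<^sub>R ?v)"
    using t \<xi> by (intro MVT2 DERIV_line fi in_S) auto
  then obtain \<eta> where "0 < \<eta>" "\<eta> < t"
    "pderiv_at i f (x + \<xi> *\<^sub>R ?u + t *\<^sub>R ?v) - pderiv_at i f (x + \<xi> *\<^sub>R ?u)
      = t * pderiv_at j (pderiv_at i f) (x + \<xi> *\<^sub>R ?u + \<eta> *\<^sub>R ?v)"
    by auto
  with \<xi> show ?thesis by (intro exI[of _ \<xi>] exI[of _ \<eta>]) (simp add: algebra_simps)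
qed

text \<open>The second difference is symmetric in \<open>i\<close> and \<open>j\<close>. It
  therefore equates values of the two mixed derivatives at two points arbitrarily close to
  \<open>x\<close>, and continuity of both carries the equality to \<open>x\<close>.\<close>

lemma pderiv_at_commute:
  fixes f :: "real^'n::finite \<Rightarrow> real"
  assumes "open S" "x \<in> S" "smooth_on S f"
  shows "pderiv_at i (pderiv_at j f) x = pderiv_at j (pderiv_at i f) x"
proof (rule ccontr)
  let ?ij = "pderiv_at i (pderiv_at j f)" and ?ji = "pderiv_at j (pderiv_at i f)"
  assume neq: "?ij x \<noteq> ?ji x"
  \<comment> \<open>Half of the supposed gap: two strict errors below \<open>e\<close> cannot add up
    to it.\<close>
  define e where "e = \<bar>?ij x - ?ji x\<bar> / 2"
  have e: "e > 0" using neq by (simp add: e_def)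
  have sm: "smooth_on S (pderiv_at i f)" "smooth_on S (pderiv_at j f)" "smooth_on S ?ij" "smooth_on S ?ji"
    using assms(3) by (auto intro: smooth_on_pderiv_at)
  obtain r0 where r0: "r0 > 0" "ball x r0 \<subseteq> S"
    using assms(1,2) openE by blast
  have "isCont ?ij x" "isCont ?ji x"
    using sm smooth_on_differentiable[OF _ assms(2)] differentiable_imp_continuous_within by blast+
  then obtain r1 r2 where r: "r1 > 0" "r2 > 0"
    "\<And>y. dist y x < r1 \<Longrightarrow> \<bar>?ij y - ?ij x\<bar> < e" "\<And>y. dist y x < r2 \<Longrightarrow> \<bar>?ji y - ?ji x\<bar> < e"
    using e unfolding continuous_at_eps_delta dist_real_def by metis
  \<comment> \<open>Points of the square lie within \<open>2 * t\<close> of \<open>x\<close>, so a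
    third of the smallest radius suffices for all three radii.\<close>
  define t where "t = min r0 (min r1 r2) / 3"
  have t: "t > 0" "2 * t < r0" "2 * t < r1" "2 * t < r2"
    using r r0 by (auto simp: t_def)
  have near: "dist (x + a *\<^sub>R axis k 1 + b *\<^sub>R axis l 1) x < 2 * t"
    if "0 < a" "a < t" "0 < b" "b < t" for a b and k l :: 'n
    using that norm_triangle_ineq[of "a *\<^sub>R (axis k 1 :: real^'n)" "b *\<^sub>R axis l 1"]
    by (simp add: dist_norm norm_axis_1 add.assoc)
  obtain a b where ab: "0 < a" "a < t" "0 < b" "b < t"
    "f (x + t *\<^sub>R axis i 1 + t *\<^sub>R axis j 1) - f (x + t *\<^sub>R axis i 1) - f (x + t *\<^sub>R axis j 1) + f x
      = t * t * ?ji (x + a *\<^sub>R axis i 1 + b *\<^sub>R axis j 1)"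
    using second_difference_mean_value[OF r0(2) t(1,2), of f i j]
      smooth_on_differentiable assms(3) sm by metis
  obtain c d where cd: "0 < c" "c < t" "0 < d" "d < t"
    "f (x + t *\<^sub>R axis j 1 + t *\<^sub>R axis i 1) - f (x + t *\<^sub>R axis j 1) - f (x + t *\<^sub>R axis i 1) + f x
      = t * t * ?ij (x + c *\<^sub>R axis j 1 + d *\<^sub>R axis i 1)"
    using second_difference_mean_value[OF r0(2) t(1,2), of f j i]
      smooth_on_differentiable assms(3) sm by metis
  have "x + t *\<^sub>R axis j 1 + t *\<^sub>R axis i 1 = x + t *\<^sub>R axis i 1 + t *\<^sub>R axis j 1"
    by simp
  then have "f (x + t *\<^sub>R axis j 1 + t *\<^sub>R axis i 1) = f (x + t *\<^sub>R axis i 1 + t *\<^sub>R axis j 1)"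
    by (rule arg_cong)
  with ab(5) cd(5) have "t * t * ?ji (x + a *\<^sub>R axis i 1 + b *\<^sub>R axis j 1) = t * t * ?ij (x + c *\<^sub>R axis j 1 + d *\<^sub>R axis i 1)"
    by linarith
  then have "?ji (x + a *\<^sub>R axis i 1 + b *\<^sub>R axis j 1) = ?ij (x + c *\<^sub>R axis j 1 + d *\<^sub>R axis i 1)"
    using t by simp
  moreover have "\<bar>?ji (x + a *\<^sub>R axis i 1 + b *\<^sub>R axis j 1) - ?ji x\<bar> < e"
    using near[OF ab(1-4), of i j] t by (intro r) auto
  moreover have "\<bar>?ij (x + c *\<^sub>R axis j 1 + d *\<^sub>R axis i 1) - ?ij x\<bar> < e"
    using near[OF cd(1-4), of j i] t by (intro r) auto
  ultimately have "\<bar>?ij x - ?ji x\<bar> < e + e" by linarith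
  then show False by (simp add: e_def)
qed

section \<open>Orthonormal frames and the Hodge star\<close>

definition pos_def_matrix :: "real^'n::finite^'n \<Rightarrow> bool" where
  "pos_def_matrix G \<longleftrightarrow> (\<forall>i j. G $ i $ j = G $ j $ i) \<and> (\<forall>v. v \<noteq> 0 \<longrightarrow> bilin G v v > 0)"

lemma bilin_inner: "bilin G u v = u \<bullet> (G *v v)"
  by (simp add: bilin_def inner_vec_def matrix_vector_mult_def sum_distrib_left mult_ac)

lemma linear_bilin_right: "linear (bilin G u)"
  by (simp add: bilin_inner[abs_def] linear_iff inner_add_right matrix_vector_right_distrib matrix_vector_mult_scaleR)

lemma linear_bilin_left: "linear (\<lambda>u. bilin G u v)"
  by (simp add: bilin_inner linear_iff inner_add_left)

lemma bilin_commute: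
  assumes "\<And>i j. G $ i $ j = G $ j $ i" shows "bilin G u v = bilin G v u"
  unfolding bilin_def by (subst sum.swap) (simp add: assms[of _ _] mult_ac)

text \<open>Since \<open>bilin G u v\<close> is the Euclidean product of \<open>u\<close> with
  \<open>G *v v\<close>, a vector Euclidean-orthogonal to the images \<open>G *v e\<^sub>i\<close>
  is orthogonal to the \<open>e\<^sub>i\<close> for the metric. The span of m < n images leaves room
  for a nonzero one, which is then normalised and appended.\<close>

lemma orthonormal_list_exists:
  fixes G :: "real^'n::finite^'n"
  assumes G: "pos_def_matrix G" and "m \<le> CARD('n)"
  shows "\<exists>e. length e = m \<and> (\<forall>i<m. \<forall>j<m. bilin G (e ! i) (e ! j) = (if i = j then 1 else 0))"
  using assms(2)
proof (induction m)
  case (Suc m)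
  then obtain e where e: "length e = m"
    "\<And>i j. i < m \<Longrightarrow> j < m \<Longrightarrow> bilin G (e ! i) (e ! j) = (if i = j then 1 else 0)"
    by auto
  have "dim ((\<lambda>v. G *v v) ` set e) \<le> card ((\<lambda>v. G *v v) ` set e)"
    by (rule dim_le_card') simp
  also have "\<dots> \<le> m"
    using card_image_le[of "set e"] card_length[of e] e(1) by (meson List.finite_set le_trans order_eq_refl)
  also have "m < DIM(real^'n)" using Suc.prems by simp
  finally obtain x where x: "x \<noteq> 0" "\<And>y. y \<in> span ((\<lambda>v. G *v v) ` set e) \<Longrightarrow> orthogonal x y"
    by (rule orthogonal_to_subspace_exists) blast
  have xe: "bilin G x (e ! i) = 0" if "i < m" for i
    using x(2)[OF span_base, of "G *v (e ! i)"] that e(1) by (auto simp: bilin_inner orthogonal_def)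
  have comm: "bilin G u v = bilin G v u" for u v
    using G by (intro bilin_commute) (simp add: pos_def_matrix_def)
  have pos: "bilin G x x > 0" using G x(1) by (simp add: pos_def_matrix_def)
  define y where "y = (1 / sqrt (bilin G x x)) *\<^sub>R x"
  have ye: "bilin G y (e ! i) = 0" "bilin G (e ! i) y = 0" if "i < m" for i
    using xe[OF that] by (simp_all add: comm[of "e ! i"] y_def linear_scale[OF linear_bilin_left])
  have yy: "bilin G y y = 1"
    using pos by (simp add: y_def linear_scale[OF linear_bilin_left] linear_scale[OF linear_bilin_right])
  show ?case
    using e ye yy by (intro exI[of _ "e @ [y]"]) (auto simp: nth_append less_Suc_eq)
qed simp

lemma orthonormal_frame_frame:
  assumes "pos_def_matrix G" shows "orthonormal_frame (bilin G) (frame (bilin G))"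
proof -
  have "\<exists>e. orthonormal_frame (bilin G) e"
    using orthonormal_list_exists[OF assms order_refl] by (simp add: orthonormal_frame_def)
  then show ?thesis unfolding frame_def by (rule someI_ex)
qed

text \<open>Frames are lists indexed by numbers, matrices are indexed by \<open>'n\<close>; this
  translates between them along an enumeration \<open>es\<close>.\<close>

lemma list_eq_map:
  assumes "distinct es" "length e = length es" obtains a where "e = map a es"
proof
  show "e = map (\<lambda>k. the (map_of (zip es e) k)) es"
    using assms by (intro nth_equalityI) (auto simp: map_of_zip_nth)
qed

lemma nths_single: "a < length xs \<Longrightarrow> nths xs {a} = [xs ! a]"
proof (induction xs arbitrary: a)
  case (Cons x xs)
  have "{j. Suc j \<in> {a}} = (if a = 0 then {} else {a - 1})" by auto
  then show ?case using Cons by (simp add: nths_Cons nth_Cons')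
qed simp

section \<open>Hodge star and products with a (1,1)-form\<close>

lemma card_1_subsets: "{I. I \<subseteq> {..<n} \<and> card I = Suc 0} = (\<lambda>a. {a}) ` {..<n::nat}"
  by (auto simp: card_Suc_eq)

lemma hodge_vector:
  fixes h :: "real^'n::finite \<Rightarrow> real^'n \<Rightarrow> real"
  assumes "length (frame h) = CARD('n)"
  shows "hodge h [u] \<alpha> = (\<Sum>a<CARD('n). h u (frame h ! a) *
     (shuffle_sign (CARD('n)) {a} * \<alpha> (nths (frame h) (- {a}))))"
proof -
  have "gram h [u] [y] = h u y" for y
  proof -
    have "{\<sigma>. \<sigma> permutes {..<length [u]}} = {id}"
      by (auto simp: lessThan_Suc permutes_sing)
    then show ?thesis by (simp add: gram_def)
  qed
  then show ?thesis
    unfolding hodge_def using assms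
    by (simp add: card_1_subsets sum.reindex inj_on_def nths_single)
qed

lemma df_star_vectors:
  fixes h :: "real^'n::finite \<Rightarrow> real^'n \<Rightarrow> real"
  assumes "length (frame h) = CARD('n)"
  shows "df_star h \<omega> [u] [v] = (\<Sum>a<CARD('n). \<Sum>b<CARD('n).
    shuffle_sign (CARD('n)) {a} * shuffle_sign (CARD('n)) {b} *
    (h u (frame h ! a) * h v (frame h ! b)) * \<omega> (nths (frame h) (- {a})) (nths (frame h) (- {b})))"
proof -
  define N where "N = int CARD('n) - 1"
  \<comment> \<open>On two single vectors both degrees are n - 1, so \<open>p + q = 2 * N\<close> is
    even and the sign is trivial.\<close>
  have "(- 1 :: real) powi ((N + N) * (int CARD('n) - N - N)) = 1"
    by (subst power_int_minus_left_even) simp_all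
  then show ?thesis
    by (simp add: df_star_def Let_def N_def df_eval_def hodge_vector[OF assms] sum_distrib_left mult_ac)
qed

text \<open>A (1,1)-form takes one argument in each slot, so only singletons contribute: this is
  Laplace expansion in both slots. The signs coincide with those in
  \<open>df_star_vectors\<close>.\<close>

lemma df_mult_df11_left:
  assumes "length xs = n" "length ys = n"
  shows "df_mult (df11 B) \<omega> xs ys = (\<Sum>a<n. \<Sum>b<n. shuffle_sign n {a} * shuffle_sign n {b} *
    B (xs ! a) (ys ! b) * \<omega> (nths xs (- {a})) (nths ys (- {b})))"
proof -
  have single: "sum f (Pow {..<n}) = (\<Sum>a<n. f {a})"
    if "\<And>I. I \<subseteq> {..<n} \<Longrightarrow> card I \<noteq> Suc 0 \<Longrightarrow> f I = 0" for f :: "nat set \<Rightarrow> real"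
  proof -
    have "sum f (Pow {..<n}) = sum f {I. I \<subseteq> {..<n} \<and> card I = Suc 0}"
      using that by (intro sum.mono_neutral_right) auto
    then show ?thesis by (simp add: card_1_subsets sum.reindex inj_on_def)
  qed
  have z1: "df11 B us vs = 0" if "length us \<noteq> Suc 0" for us vs
    using that by (auto simp: df11_def split: list.split)
  have z2: "df11 B us vs = 0" if "length vs \<noteq> Suc 0" for us vs
    using that by (auto simp: df11_def split: list.split)
  have "df_mult (df11 B) \<omega> xs ys = (\<Sum>a<n. \<Sum>b<n. shuffle_sign n {a} * shuffle_sign n {b} *
    df11 B (nths xs {a}) (nths ys {b}) * \<omega> (nths xs (- {a})) (nths ys (- {b})))"
    unfolding df_mult_def assms
    by (subst single, (rule sum.neutral ballI)+, simp add: z1 length_nths_subset assms)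
       (intro sum.cong refl single, simp add: z2 length_nths_subset assms)
  then show ?thesis using assms by (simp add: nths_single df11_def)
qed

text \<open>The star turns \<open>e\<^sub>i\<close> into the signed product of the other frame
  vectors. Hence the star of \<omega> at a pair of frame vectors is a signed value of \<omega> with
  these two vectors removed, and summing against \<open>B\<close> reproduces the Laplace expansion
  of the product.\<close>

lemma inner11_df_star:
  assumes "orthonormal_frame h (frame h)"
  shows "inner11 h (\<lambda>u v. df_star h \<omega> [u] [v]) B = df_mult (df11 B) \<omega> (frame h) (frame h)"
proof -
  let ?e = "frame h" and ?n = "CARD('a)"
  have len: "length ?e = ?n" using assms by (simp add: orthonormal_frame_def)
  have "df_star h \<omega> [?e ! i] [?e ! j] =
      shuffle_sign ?n {i} * shuffle_sign ?n {j} * \<omega> (nths ?e (- {i})) (nths ?e (- {j}))"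
    if "i < ?n" "j < ?n" for i j
  proof -
    have "df_star h \<omega> [?e ! i] [?e ! j] = (\<Sum>a<?n. \<Sum>b<?n. if b = j then if a = i then
        shuffle_sign ?n {a} * shuffle_sign ?n {b} * \<omega> (nths ?e (- {a})) (nths ?e (- {b})) else 0 else 0)"
      unfolding df_star_vectors[OF len] using assms that
      by (intro sum.cong refl) (auto simp: orthonormal_frame_def)
    then show ?thesis using that by simp
  qed
  then show ?thesis
    unfolding inner11_def df_mult_df11_left[OF len len] by (intro sum.cong refl) simp
qed

text \<open>\<open>v\<close> is the metric dual of \<xi>: the metric pairs it with each frame vector
  exactly as \<xi> does. Its coefficients in the expansion of the star are then those of \<xi> in
  the Laplace expansion.\<close>

lemma df_star_dual_vector:
  fixes h :: "real^'n::finite \<Rightarrow> real^'n \<Rightarrow> real" and \<xi> :: "real^'n"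
  assumes "orthonormal_frame h (frame h)" "\<And>y. linear (\<lambda>x. h x y)"
  defines "v \<equiv> \<Sum>a<CARD('n). (\<xi> \<bullet> (frame h ! a)) *\<^sub>R frame h ! a"
  shows "df_star h \<omega> [v] [v] = df_mult (df11 (\<lambda>u w. (\<xi> \<bullet> u) * (\<xi> \<bullet> w))) \<omega> (frame h) (frame h)"
    and "i < CARD('n) \<Longrightarrow> h v (frame h ! i) = \<xi> \<bullet> (frame h ! i)"
proof -
  let ?e = "frame h"
  have len: "length ?e = CARD('n)" using assms by (simp add: orthonormal_frame_def)
  have hv: "h v (?e ! i) = \<xi> \<bullet> (?e ! i)" if "i < CARD('n)" for i
  proof -
    have "h v (?e ! i) = (\<Sum>a<CARD('n). (\<xi> \<bullet> (?e ! a)) * h (?e ! a) (?e ! i))"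
      unfolding v_def by (simp add: linear_sum[OF assms(2)] linear_scale[OF assms(2)])
    also have "\<dots> = (\<Sum>a<CARD('n). if a = i then \<xi> \<bullet> (?e ! a) else 0)"
      using assms(1) that by (intro sum.cong refl) (auto simp: orthonormal_frame_def)
    finally show ?thesis using that by simp
  qed
  then show "i < CARD('n) \<Longrightarrow> h v (frame h ! i) = \<xi> \<bullet> (frame h ! i)" by blast
  show "df_star h \<omega> [v] [v] = df_mult (df11 (\<lambda>u w. (\<xi> \<bullet> u) * (\<xi> \<bullet> w))) \<omega> ?e ?e"
    unfolding df_star_vectors[OF len] df_mult_df11_left[OF len len]
    by (intro sum.cong refl) (simp add: hv)
qed

lemma matrix_congruence_component:
  "(A ** G ** transpose A) $ k $ l = bilin G (A $ k) (A $ l)"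
  by (simp add: bilin_inner inner_vec_def matrix_matrix_mult_def transpose_def
      matrix_vector_mult_def sum_distrib_left sum_distrib_right mult_ac) (rule sum.swap)

text \<open>The rows of \<open>A\<close> are the frame vectors in coordinates. Orthonormality reads
  \<open>A ** G ** transpose A = mat 1\<close>, and taking determinants gives the second
  claim.\<close>

lemma orthonormal_frame_coordinates:
  fixes G :: "real^'n::finite^'n"
  assumes "orthonormal_frame (bilin G) e" "distinct es" "set es = UNIV"
  obtains A where "e = map (\<lambda>k. \<Sum>j\<in>UNIV. A $ k $ j *\<^sub>R axis j 1) es" "(det A)\<^sup>2 * det G = 1"
proof -
  have len: "length es = CARD('n)"
    using assms(2,3) distinct_card by fastforce
  then obtain a where a: "e = map a es"
    using assms list_eq_map[of es e] by (metis orthonormal_frame_def)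
  define A :: "real^'n^'n" where "A = (\<chi> k. a k)"
  have "a k = (\<Sum>j\<in>UNIV. A $ k $ j *\<^sub>R axis j 1)" for k
    using basis_expansion[of "a k"] by (simp add: A_def scalar_mult_eq_scaleR)
  then have "e = map (\<lambda>k. \<Sum>j\<in>UNIV. A $ k $ j *\<^sub>R axis j 1) es" using a by simp
  moreover have "A ** G ** transpose A = mat 1"
  proof -
    have "bilin G (a k) (a l) = (if k = l then 1 else 0)" for k l
    proof -
      obtain i j where ij: "i < CARD('n)" "j < CARD('n)" "es ! i = k" "es ! j = l"
        using assms(3) len by (metis UNIV_I in_set_conv_nth)
      then have "k = l \<longleftrightarrow> i = j" using assms(2) len nth_eq_iff_index_eq by metis
      then show ?thesis using assms(1) ij len unfolding orthonormal_frame_def a by force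
    qed
    then show ?thesis
      by (simp add: vec_eq_iff matrix_congruence_component A_def mat_def)
  qed
  then have "det A * det G * det A = 1"
    by (metis det_I det_mul det_transpose)
  then have "(det A)\<^sup>2 * det G = 1" by (simp add: power2_eq_square mult_ac)
  ultimately show ?thesis using that by blast
qed

lemma det_pos_def_matrix:
  fixes G :: "real^'n::finite^'n"
  assumes "pos_def_matrix G" shows "det G > 0"
proof -
  obtain es :: "'n list" where es: "distinct es" "set es = UNIV"
    using finite_distinct_list[OF finite] by blast
  obtain A :: "real^'n^'n" where "(det A)\<^sup>2 * det G = 1"
    using orthonormal_frame_coordinates[OF orthonormal_frame_frame[OF assms] es] by blast
  then show ?thesis by (metis zero_le_power2 zero_less_mult_pos less_eq_real_def mult_zero_left zero_less_one)
qed

section \<open>Naturality and smoothness of products of double forms\<close>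

lemma df_mult_map:
  assumes "\<And>xs ys. \<omega> (map f xs) (map f ys) = \<omega>' xs ys" "\<And>xs ys. \<eta> (map f xs) (map f ys) = \<eta>' xs ys"
  shows "df_mult \<omega> \<eta> (map f xs) (map f ys) = df_mult \<omega>' \<eta>' xs ys"
  by (simp add: df_mult_def nths_map assms)

lemma df_power_map:
  assumes "\<And>xs ys. \<omega> (map f xs) (map f ys) = \<omega>' xs ys"
  shows "df_power \<omega> m (map f xs) (map f ys) = df_power \<omega>' m xs ys"
  by (induction m arbitrary: xs ys) (simp_all add: df_one_def df_mult_map assms)

lemma df11_map: "df11 B (map f xs) (map f ys) = df11 (\<lambda>x y. B (f x) (f y)) xs ys"
  by (auto simp: df11_def split: list.split)

lemma df22_map:
  "df22 R (map f xs) (map f ys) = df22 (\<lambda>a b c d. R (f a) (f b) (f c) (f d)) xs ys"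
  by (auto simp: df22_def split: list.split)

text \<open>The argument lists are held fixed while the point varies; this fits the coordinate
  basis, whose vectors are constant in a chart.\<close>

lemma smooth_on_df_mult:
  assumes "open S" "\<And>xs ys. smooth_on S (\<lambda>x. \<omega> x xs ys)" "\<And>xs ys. smooth_on S (\<lambda>x. \<eta> x xs ys)"
  shows "smooth_on S (\<lambda>x. df_mult (\<omega> x) (\<eta> x) xs ys)"
  unfolding df_mult_def by (intro smooth_on_sum smooth_on_mult smooth_on_const assms)

lemma smooth_on_df_power:
  assumes "open S" "\<And>xs ys. smooth_on S (\<lambda>x. \<omega> x xs ys)"
  shows "smooth_on S (\<lambda>x. df_power (\<omega> x) m xs ys)"
  by (induction m arbitrary: xs ys) (simp_all add: smooth_on_const smooth_on_df_mult assms)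

lemma smooth_on_df11:
  assumes "\<And>u v. smooth_on S (\<lambda>x. B x u v)" shows "smooth_on S (\<lambda>x. df11 (B x) xs ys)"
proof (cases "\<exists>u v. xs = [u] \<and> ys = [v]")
  case True
  then show ?thesis using assms by (auto simp: df11_def)
next
  case False
  then have "df11 (B x) xs ys = 0" for x
    by (auto simp: df11_def split: list.split)
  then show ?thesis by (simp add: smooth_on_const)
qed

lemma smooth_on_df22:
  assumes "\<And>a b c d. smooth_on S (\<lambda>x. R x a b c d)" shows "smooth_on S (\<lambda>x. df22 (R x) xs ys)"
proof (cases "\<exists>a b c d. xs = [a, b] \<and> ys = [c, d]")
  case True
  then show ?thesis using assms by (auto simp: df22_def)
next
  case False
  then have "df22 (R x) xs ys = 0" for x
    by (auto simp: df22_def split: list.split)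
  then show ?thesis by (simp add: smooth_on_const)
qed

section \<open>Curvature in a chart\<close>

lemma bilin_sum_left: "bilin G (\<Sum>i\<in>I. c i *\<^sub>R a i) v = (\<Sum>i\<in>I. c i * bilin G (a i) v)"
  by (simp add: linear_sum[OF linear_bilin_left] linear_scale[OF linear_bilin_left])

lemma bilin_sum_right: "bilin G u (\<Sum>i\<in>I. c i *\<^sub>R a i) = (\<Sum>i\<in>I. c i * bilin G u (a i))"
  by (simp add: linear_sum[OF linear_bilin_right] linear_scale[OF linear_bilin_right])

lemma bilin_add_right: "bilin G u (v + w) = bilin G u v + bilin G u w"
  by (simp add: linear_add[OF linear_bilin_right])

lemma sum_swap_pairs:
  "(\<Sum>i\<in>I. \<Sum>j\<in>J. \<Sum>a\<in>A. \<Sum>k\<in>K. f i j a k) = (\<Sum>a\<in>A. \<Sum>k\<in>K. \<Sum>i\<in>I. \<Sum>j\<in>J. f i j a k)"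
proof -
  have "(\<Sum>i\<in>I. \<Sum>j\<in>J. \<Sum>a\<in>A. \<Sum>k\<in>K. f i j a k) = (\<Sum>i\<in>I. \<Sum>a\<in>A. \<Sum>k\<in>K. \<Sum>j\<in>J. f i j a k)"
    by (intro sum.cong refl, subst sum.swap) (intro sum.cong refl sum.swap)
  also have "\<dots> = (\<Sum>a\<in>A. \<Sum>k\<in>K. \<Sum>i\<in>I. \<Sum>j\<in>J. f i j a k)"
    by (subst sum.swap) (intro sum.cong refl sum.swap)
  finally show ?thesis .
qed

lemma sum_rotate3:
  "(\<Sum>s\<in>S. \<Sum>i\<in>I. \<Sum>j\<in>J. f s i j) = (\<Sum>i\<in>I. \<Sum>j\<in>J. \<Sum>s\<in>S. f s i j)"
  by (subst sum.swap) (rule sum.cong[OF refl], rule sum.swap)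

lemma sum_rotate4:
  "(\<Sum>s\<in>S. \<Sum>i\<in>I. \<Sum>j\<in>J. \<Sum>k\<in>K. f s i j k) = (\<Sum>i\<in>I. \<Sum>j\<in>J. \<Sum>k\<in>K. \<Sum>s\<in>S. f s i j k)"
  by (subst sum.swap) (rule sum.cong[OF refl], rule sum_rotate3)

locale coordinate_metric =
  fixes G :: "real^'n::finite \<Rightarrow> real^'n^'n" and U :: "(real^'n) set"
  assumes open_U: "open U"
    and smooth_G: "\<And>i j. smooth_on U (\<lambda>x. G x $ i $ j)"
    and pos_def_G: "\<And>x. x \<in> U \<Longrightarrow> pos_def_matrix (G x)"
begin

lemma G_commute: "x \<in> U \<Longrightarrow> G x $ i $ j = G x $ j $ i"
  using pos_def_G by (simp add: pos_def_matrix_def)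

lemma det_G: "x \<in> U \<Longrightarrow> det (G x) > 0"
  using pos_def_G det_pos_def_matrix by blast

lemma smooth_christoffel: "smooth_on U (christoffel G k i j)"
proof -
  have "smooth_on U (\<lambda>x. matrix_inv (G x) $ k $ l)" for k l
    using det_G by (intro smooth_on_matrix_inv open_U smooth_G) force
  then show ?thesis
    unfolding christoffel_def[abs_def]
    by (intro smooth_on_mult smooth_on_const smooth_on_sum smooth_on_add smooth_on_diff
        smooth_on_pderiv_at smooth_G open_U)
qed

lemma smooth_curvature_op: "smooth_on U (curvature_op G i j k l)"
  unfolding curvature_op_def[abs_def]
  by (intro smooth_on_add smooth_on_diff smooth_on_sum smooth_on_mult smooth_on_pderiv_at
      smooth_christoffel open_U)

lemma smooth_riemann: "smooth_on U (\<lambda>x. riemann G x u v w z)"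
  unfolding riemann_def
  by (intro smooth_on_sum smooth_on_mult smooth_on_const smooth_curvature_op smooth_G open_U)

lemma smooth_bilin: "smooth_on U (\<lambda>x. bilin (G x) u v)"
  unfolding bilin_def by (intro smooth_on_sum smooth_on_mult smooth_on_const smooth_G open_U)

lemma christoffel_lowered:
  assumes "x \<in> U"
  shows "(\<Sum>k\<in>UNIV. christoffel G k i j x * G x $ k $ l) =
    1/2 * (pderiv_at i (\<lambda>y. G y $ j $ l) x + pderiv_at j (\<lambda>y. G y $ i $ l) x
      - pderiv_at l (\<lambda>y. G y $ i $ j) x)"
proof -
  let ?C = "\<lambda>l. pderiv_at i (\<lambda>y. G y $ j $ l) x + pderiv_at j (\<lambda>y. G y $ i $ l) x
      - pderiv_at l (\<lambda>y. G y $ i $ j) x"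
  have "(G x ** matrix_inv (G x)) $ l $ m = (if m = l then 1 else 0)" for m
    using det_G[OF assms] by (simp add: matrix_mult_matrix_inv mat_def)
  \<comment> \<open>The matrix product sums over the second index of \<open>G\<close>; symmetry
    moves it to the first, where the upper index of the Christoffel symbol is contracted.\<close>
  then have inv: "(\<Sum>k\<in>UNIV. matrix_inv (G x) $ k $ m * G x $ k $ l) = (if m = l then 1 else 0)" for m
    by (simp add: matrix_matrix_mult_def G_commute[OF assms, of _ l] mult.commute)
  have "(\<Sum>k\<in>UNIV. christoffel G k i j x * G x $ k $ l)
      = (\<Sum>k\<in>UNIV. \<Sum>m\<in>UNIV. 1/2 * ?C m * (matrix_inv (G x) $ k $ m * G x $ k $ l))"
    by (simp add: christoffel_def sum_distrib_left sum_distrib_right mult_ac)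
  also have "\<dots> = (\<Sum>m\<in>UNIV. 1/2 * ?C m * (\<Sum>k\<in>UNIV. matrix_inv (G x) $ k $ m * G x $ k $ l))"
    by (subst sum.swap) (simp add: sum_distrib_left)
  also have "\<dots> = (\<Sum>m\<in>UNIV. if m = l then 1/2 * ?C m else 0)"
    unfolding inv by (intro sum.cong) auto
  finally show ?thesis by simp
qed

lemma pderiv_G_commute: "x \<in> U \<Longrightarrow> pderiv_at i (\<lambda>y. G y $ k $ l) x = pderiv_at i (\<lambda>y. G y $ l $ k) x"
  by (rule pderiv_at_cong_open[OF open_U _ G_commute])

text \<open>On adding the two lowered Christoffel formulas, the derivatives in directions
  \<open>k\<close> and \<open>l\<close> cancel in pairs and two halves of the derivative in
  direction \<open>i\<close> remain.\<close>

lemma metric_compatible: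
  assumes "x \<in> U"
  shows "pderiv_at i (\<lambda>y. G y $ k $ l) x =
    (\<Sum>m\<in>UNIV. christoffel G m i k x * G x $ m $ l) + (\<Sum>m\<in>UNIV. christoffel G m i l x * G x $ m $ k)"
  unfolding christoffel_lowered[OF assms]
  using pderiv_G_commute[OF assms, of i l k] by (simp add: field_simps)

lemma curvature_op_antisym: "curvature_op G j i k l x = - curvature_op G i j k l x"
  by (simp add: curvature_op_def sum_subtractf)

text \<open>The second derivative of \<open>G y $ k $ l\<close> is computed from compatibility with
  the metric. Antisymmetrised in \<open>i\<close> and \<open>j\<close> it vanishes, the products of
  two first covariant derivatives cancel, and what remains is the curvature symmetrised in
  \<open>k\<close> and \<open>l\<close>.\<close>

lemma curvature_lowered_skew:
  assumes x: "x \<in> U"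
  shows "(\<Sum>m\<in>UNIV. G x $ m $ l * curvature_op G i j k m x) + (\<Sum>m\<in>UNIV. G x $ m $ k * curvature_op G i j l m x) = 0"
proof -
  define \<Gamma> where "\<Gamma> m i j = christoffel G m i j x" for m i j
  define d\<Gamma> where "d\<Gamma> a m i j = pderiv_at a (christoffel G m i j) x" for a m i j
  define g where "g k l = G x $ k $ l" for k l
  \<comment> \<open>\<open>P i j k l\<close> is the metric product of
    \<open>\<nabla>\<^sub>i \<nabla>\<^sub>j \<partial>\<^sub>k\<close> with
    \<open>\<partial>\<^sub>l\<close>, and \<open>Q i j k l\<close> that of
    \<open>\<nabla>\<^sub>j \<partial>\<^sub>k\<close> with
    \<open>\<nabla>\<^sub>i \<partial>\<^sub>l\<close>.\<close>
  define P where "P i j k l = (\<Sum>m\<in>UNIV. (d\<Gamma> i m j k + (\<Sum>s\<in>UNIV. \<Gamma> m i s * \<Gamma> s j k)) * g m l)" for i j k l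
  define Q where "Q i j k l = (\<Sum>m\<in>UNIV. \<Sum>s\<in>UNIV. \<Gamma> m j k * \<Gamma> s i l * g s m)" for i j k l
  have g: "g k l = g l k" for k l
    using G_commute[OF x] by (simp add: g_def)
  have diff: "christoffel G m i j differentiable (at x)" "(\<lambda>y. G y $ k $ l) differentiable (at x)"
    for m i j k l
    using smooth_on_differentiable[OF smooth_christoffel x] smooth_on_differentiable[OF smooth_G x] by blast+
  have half: "pderiv_at i (\<lambda>y. \<Sum>m\<in>UNIV. christoffel G m j k y * G y $ m $ l) x = P i j k l + Q i j k l" for i j k l
  proof -
    have "pderiv_at i (\<lambda>y. \<Sum>m\<in>UNIV. christoffel G m j k y * G y $ m $ l) x
        = (\<Sum>m\<in>UNIV. \<Gamma> m j k * pderiv_at i (\<lambda>y. G y $ m $ l) x + d\<Gamma> i m j k * g m l)"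
      by (simp add: pderiv_at_sum pderiv_at_mult diff differentiable_mult \<Gamma>_def d\<Gamma>_def g_def)
    also have "\<dots> = (\<Sum>m\<in>UNIV. d\<Gamma> i m j k * g m l) + (\<Sum>m\<in>UNIV. \<Sum>s\<in>UNIV. \<Gamma> m j k * (\<Gamma> s i m * g s l)) + Q i j k l"
      unfolding metric_compatible[OF x] Q_def
      by (simp add: sum.distrib sum_distrib_left distrib_left mult.assoc \<Gamma>_def g_def)
    also have "(\<Sum>m\<in>UNIV. \<Sum>s\<in>UNIV. \<Gamma> m j k * (\<Gamma> s i m * g s l))
        = (\<Sum>m\<in>UNIV. \<Sum>s\<in>UNIV. \<Gamma> m i s * \<Gamma> s j k * g m l)"
      by (subst sum.swap) (simp add: mult_ac)
    finally show ?thesis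
      by (simp add: P_def distrib_right sum.distrib sum_distrib_right)
  qed
  have second: "pderiv_at i (pderiv_at j (\<lambda>y. G y $ k $ l)) x = P i j k l + Q i j k l + (P i j l k + Q i j l k)" for i j k l
  proof -
    have "pderiv_at i (pderiv_at j (\<lambda>y. G y $ k $ l)) x = pderiv_at i (\<lambda>y.
        (\<Sum>m\<in>UNIV. christoffel G m j k y * G y $ m $ l) + (\<Sum>m\<in>UNIV. christoffel G m j l y * G y $ m $ k)) x"
      by (rule pderiv_at_cong_open[OF open_U x metric_compatible])
    also have "\<dots> = pderiv_at i (\<lambda>y. \<Sum>m\<in>UNIV. christoffel G m j k y * G y $ m $ l) x
        + pderiv_at i (\<lambda>y. \<Sum>m\<in>UNIV. christoffel G m j l y * G y $ m $ k) x"
      by (auto intro!: pderiv_at_add differentiable_sum differentiable_mult diff)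
    finally show ?thesis unfolding half .
  qed
  \<comment> \<open>Exchanging both index pairs swaps the two factors of the metric product.\<close>
  have QQ: "Q i j k l = Q j i l k" for i j k l
    unfolding Q_def by (subst sum.swap) (simp add: mult_ac g)
  have "P i j k l + P i j l k = P j i k l + P j i l k"
    using pderiv_at_commute[OF open_U x smooth_G, of i j k l]
    unfolding second using QQ[of i j k l] QQ[of i j l k] by linarith
  moreover have "(\<Sum>m\<in>UNIV. G x $ m $ l * curvature_op G i j k m x) = P i j k l - P j i k l" for i j k l
    unfolding P_def curvature_op_def sum_subtractf[symmetric]
    by (intro sum.cong refl) (simp add: sum_subtractf \<Gamma>_def d\<Gamma>_def g_def algebra_simps)
  ultimately show ?thesis by simp
qed

lemma riemann_skew_left: "riemann G x u u w z = 0"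
proof -
  define C where "C i j = (\<Sum>a\<in>UNIV. \<Sum>k\<in>UNIV. w $ a * z $ k * (\<Sum>l\<in>UNIV. G x $ l $ a * curvature_op G i j k l x))" for i j
  have C: "C j i = - C i j" for i j
    unfolding C_def by (simp add: curvature_op_antisym[of j i] sum_negf)
  have eq: "riemann G x u u w z = (\<Sum>i\<in>UNIV. \<Sum>j\<in>UNIV. u $ i * u $ j * C i j)"
    by (simp add: riemann_def C_def sum_distrib_left mult_ac)
  also have "\<dots> = (\<Sum>i\<in>UNIV. \<Sum>j\<in>UNIV. u $ j * u $ i * C j i)"
    by (rule sum.swap)
  also have "\<dots> = - (\<Sum>i\<in>UNIV. \<Sum>j\<in>UNIV. u $ i * u $ j * C i j)"
    unfolding sum_negf[symmetric] by (intro sum.cong refl) (subst C, simp)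
  finally show ?thesis using eq by simp
qed

lemma riemann_skew_right:
  assumes "x \<in> U" shows "riemann G x u v w w = 0"
proof -
  define C where "C a k = (\<Sum>i\<in>UNIV. \<Sum>j\<in>UNIV. u $ i * v $ j * (\<Sum>l\<in>UNIV. G x $ l $ a * curvature_op G i j k l x))" for a k
  have C: "C a k + C k a = 0" for a k
  proof -
    have "C a k + C k a = (\<Sum>i\<in>UNIV. \<Sum>j\<in>UNIV. u $ i * v $ j *
        ((\<Sum>l\<in>UNIV. G x $ l $ a * curvature_op G i j k l x) + (\<Sum>l\<in>UNIV. G x $ l $ k * curvature_op G i j a l x)))"
      by (simp add: C_def sum.distrib distrib_left)
    then show ?thesis by (simp add: curvature_lowered_skew[OF assms])
  qed
  have eq: "riemann G x u v w w = (\<Sum>a\<in>UNIV. \<Sum>k\<in>UNIV. w $ a * w $ k * C a k)"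
    unfolding riemann_def by (subst sum_swap_pairs) (simp add: C_def sum_distrib_left mult_ac)
  also have "\<dots> = (\<Sum>a\<in>UNIV. \<Sum>k\<in>UNIV. w $ k * w $ a * C k a)"
    by (rule sum.swap)
  finally have "2 * riemann G x u v w w = (\<Sum>a\<in>UNIV. \<Sum>k\<in>UNIV. w $ a * w $ k * (C a k + C k a))"
    using eq by (simp add: distrib_left sum.distrib mult_ac)
  then show ?thesis by (simp add: C)
qed

text \<open>This is where the curvature identities enter the algebra of double forms: alternation in
  both pairs makes the determinant rule available for products containing the curvature.\<close>

lemma df_alternating_riemann: "x \<in> U \<Longrightarrow> df_alternating (df22 (riemann G x))"
proof (rule df_alternating_df22)
  note [simp] = riemann_def linear_iff distrib_left distrib_right sum.distrib sum_distrib_left mult_ac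
  show "linear (\<lambda>a. riemann G x a b c d)" for b c d by simp
  show "linear (\<lambda>b. riemann G x a b c d)" for a c d by simp
  show "linear (\<lambda>c. riemann G x a b c d)" for a b d by simp
  show "linear (\<lambda>d. riemann G x a b c d)" for a b c by simp
qed (auto simp: riemann_skew_left riemann_skew_right)

end

section \<open>Change of coordinates\<close>

text \<open>The derivative of the bilinear form \<open>B\<close> in direction \<open>w\<close>, with
  \<open>u\<close> and \<open>v\<close> held constant. Together with the next two definitions it
  allows the connection of one chart to be evaluated on vectors coming from another chart.\<close>

definition dbilin :: "(real^'n::finite \<Rightarrow> real^'n^'n) \<Rightarrow> real^'n \<Rightarrow> real^'n \<Rightarrow> real^'n \<Rightarrow> real^'n \<Rightarrow> real" where
  "dbilin B y w u v = (\<Sum>p\<in>UNIV. w $ p * bilin (\<chi> r s. pderiv_at p (\<lambda>z. B z $ r $ s) y) u v)"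

definition christoffel_matrix :: "(real^'n::finite \<Rightarrow> real^'n^'n) \<Rightarrow> 'n \<Rightarrow> real^'n \<Rightarrow> real^'n^'n" where
  "christoffel_matrix G m y = (\<chi> p q. christoffel G m p q y)"

definition christoffel_vec :: "(real^'n::finite \<Rightarrow> real^'n^'n) \<Rightarrow> real^'n \<Rightarrow> real^'n \<Rightarrow> real^'n \<Rightarrow> real^'n" where
  "christoffel_vec G y u v = (\<chi> m. bilin (christoffel_matrix G m y) u v)"

text \<open>The vector \<open>R(u, v) z\<close> for fields with constant coefficients: the terms are
  those of \<open>\<nabla>\<^sub>u \<nabla>\<^sub>v z - \<nabla>\<^sub>v \<nabla>\<^sub>u z\<close>,
  where \<open>\<nabla>\<^sub>v z\<close> is \<open>christoffel_vec G y v z\<close>.\<close>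

definition curvature_vec ::
    "(real^'n::finite \<Rightarrow> real^'n^'n) \<Rightarrow> real^'n \<Rightarrow> real^'n \<Rightarrow> real^'n \<Rightarrow> real^'n \<Rightarrow> real^'n" where
  "curvature_vec G y u v z = (\<chi> m. dbilin (christoffel_matrix G m) y u v z - dbilin (christoffel_matrix G m) y v u z
     + bilin (christoffel_matrix G m y) u (christoffel_vec G y v z)
     - bilin (christoffel_matrix G m y) v (christoffel_vec G y u z))"

lemma curvature_vec_components:
  "curvature_vec G y u v z $ m =
    (\<Sum>i\<in>UNIV. \<Sum>j\<in>UNIV. \<Sum>k\<in>UNIV. u $ i * v $ j * z $ k * curvature_op G i j k m y)"
proof -
  define D where "D a p q = pderiv_at a (christoffel G m p q) y" for a p q
  define C where "C r p q = christoffel G r p q y" for r p q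
  have d1: "dbilin (christoffel_matrix G m) y u v z = (\<Sum>i\<in>UNIV. \<Sum>j\<in>UNIV. \<Sum>k\<in>UNIV. u $ i * v $ j * z $ k * D i j k)" for u v z
    by (simp add: dbilin_def bilin_def christoffel_matrix_def D_def sum_distrib_left mult_ac)
  have d2: "dbilin (christoffel_matrix G m) y v u z = (\<Sum>i\<in>UNIV. \<Sum>j\<in>UNIV. \<Sum>k\<in>UNIV. u $ i * v $ j * z $ k * D j i k)"
    unfolding d1 by (subst sum.swap) (simp add: mult_ac)
  have c1: "bilin (christoffel_matrix G m y) u (christoffel_vec G y v z)
      = (\<Sum>i\<in>UNIV. \<Sum>j\<in>UNIV. \<Sum>k\<in>UNIV. u $ i * v $ j * z $ k * (\<Sum>s\<in>UNIV. C m i s * C s j k))" for u v z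
  proof -
    have "bilin (christoffel_matrix G m y) u (christoffel_vec G y v z)
      = (\<Sum>i\<in>UNIV. \<Sum>s\<in>UNIV. \<Sum>j\<in>UNIV. \<Sum>k\<in>UNIV. u $ i * v $ j * z $ k * (C m i s * C s j k))"
      by (simp add: christoffel_vec_def bilin_def christoffel_matrix_def C_def sum_distrib_left mult_ac)
    also have "\<dots> = (\<Sum>i\<in>UNIV. \<Sum>j\<in>UNIV. \<Sum>k\<in>UNIV. \<Sum>s\<in>UNIV. u $ i * v $ j * z $ k * (C m i s * C s j k))"
      by (rule sum.cong[OF refl], rule sum_rotate3)
    finally show ?thesis by (simp add: sum_distrib_left)
  qed
  have c2: "bilin (christoffel_matrix G m y) v (christoffel_vec G y u z)
      = (\<Sum>i\<in>UNIV. \<Sum>j\<in>UNIV. \<Sum>k\<in>UNIV. u $ i * v $ j * z $ k * (\<Sum>s\<in>UNIV. C m j s * C s i k))"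
    unfolding c1 by (subst sum.swap) (simp add: mult_ac)
  show ?thesis
    unfolding curvature_vec_def d1[of u v z] d2 c1[of u v z] c2 vec_lambda_beta curvature_op_def
    by (simp add: D_def[symmetric] C_def[symmetric] sum_subtractf distrib_left right_diff_distrib sum.distrib)
qed

lemma riemann_curvature_vec: "riemann G y u v w z = bilin (G y) (curvature_vec G y u v z) w"
proof -
  have "riemann G y u v w z = (\<Sum>i\<in>UNIV. \<Sum>j\<in>UNIV. \<Sum>a\<in>UNIV. \<Sum>k\<in>UNIV. \<Sum>l\<in>UNIV.
      u $ i * v $ j * z $ k * curvature_op G i j k l y * (G y $ l $ a * w $ a))"
    by (simp add: riemann_def sum_distrib_left mult_ac)
  also have "\<dots> = (\<Sum>a\<in>UNIV. \<Sum>i\<in>UNIV. \<Sum>j\<in>UNIV. \<Sum>k\<in>UNIV. \<Sum>l\<in>UNIV.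
      u $ i * v $ j * z $ k * curvature_op G i j k l y * (G y $ l $ a * w $ a))"
    by (rule sum_rotate3[symmetric])
  also have "\<dots> = (\<Sum>a\<in>UNIV. \<Sum>l\<in>UNIV. \<Sum>i\<in>UNIV. \<Sum>j\<in>UNIV. \<Sum>k\<in>UNIV.
      u $ i * v $ j * z $ k * curvature_op G i j k l y * (G y $ l $ a * w $ a))"
    by (rule sum.cong[OF refl], rule sum_rotate4[symmetric])
  also have "\<dots> = (\<Sum>l\<in>UNIV. \<Sum>a\<in>UNIV. curvature_vec G y u v z $ l * (G y $ l $ a * w $ a))"
    by (subst sum.swap) (simp add: curvature_vec_components sum_distrib_right)
  finally show ?thesis by (simp add: bilin_def mult_ac)
qed

lemma differentiable_bilin:
  assumes "\<And>r s. (\<lambda>y. B y $ r $ s) differentiable (at x)"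
    and "\<And>r. (\<lambda>y. X y $ r) differentiable (at x)" "\<And>r. (\<lambda>y. Y y $ r) differentiable (at x)"
  shows "(\<lambda>y. bilin (B y) (X y) (Y y)) differentiable (at x)"
  unfolding bilin_def by (auto intro!: differentiable_sum differentiable_mult assms)

lemma pderiv_at_bilin:
  assumes "\<And>r s. (\<lambda>y. B y $ r $ s) differentiable (at x)"
    and "\<And>r. (\<lambda>y. X y $ r) differentiable (at x)" "\<And>r. (\<lambda>y. Y y $ r) differentiable (at x)"
  shows "pderiv_at i (\<lambda>y. bilin (B y) (X y) (Y y)) x =
    bilin (\<chi> r s. pderiv_at i (\<lambda>y. B y $ r $ s) x) (X x) (Y x)
    + bilin (B x) (\<chi> r. pderiv_at i (\<lambda>y. X y $ r) x) (Y x)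
    + bilin (B x) (X x) (\<chi> r. pderiv_at i (\<lambda>y. Y y $ r) x)"
proof -
  have "pderiv_at i (\<lambda>y. bilin (B y) (X y) (Y y)) x = (\<Sum>r\<in>UNIV. \<Sum>s\<in>UNIV.
      B x $ r $ s * X x $ r * pderiv_at i (\<lambda>y. Y y $ s) x
      + (B x $ r $ s * pderiv_at i (\<lambda>y. X y $ r) x + pderiv_at i (\<lambda>y. B y $ r $ s) x * X x $ r) * Y x $ s)"
    unfolding bilin_def
    by (simp add: pderiv_at_sum pderiv_at_mult differentiable_mult differentiable_sum assms)
  then show ?thesis
    by (simp add: bilin_def sum.distrib distrib_right add_ac)
qed

locale coordinate_change = c: coordinate_metric G U + d: coordinate_metric G' U'
  for G G' :: "real^'n::finite \<Rightarrow> real^'n^'n" and U U' +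
  fixes W :: "(real^'n) set" and \<phi> :: "real^'n \<Rightarrow> real^'n"
  assumes open_W: "open W" and W_sub: "W \<subseteq> U" and \<phi>_in: "\<And>x. x \<in> W \<Longrightarrow> \<phi> x \<in> U'"
    and smooth_\<phi>: "\<And>p. smooth_on W (\<lambda>x. \<phi> x $ p)"
    and transform: "\<And>x i j. x \<in> W \<Longrightarrow> G x $ i $ j = (\<Sum>k\<in>UNIV. \<Sum>l\<in>UNIV. G' (\<phi> x) $ k $ l *
      pderiv_at i (\<lambda>y. \<phi> y $ k) x * pderiv_at j (\<lambda>y. \<phi> y $ l) x)"
begin

text \<open>The image of the \<open>i\<close>-th coordinate vector under the differential of \<phi>;
  \<open>K\<close> below collects the second derivatives, the source of all non-tensorial
  terms.\<close>

definition J :: "'n \<Rightarrow> real^'n \<Rightarrow> real^'n" where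
  "J i x = (\<chi> p. pderiv_at i (\<lambda>y. \<phi> y $ p) x)"

definition K :: "'n \<Rightarrow> 'n \<Rightarrow> real^'n \<Rightarrow> real^'n" where
  "K i j x = (\<chi> p. pderiv_at i (\<lambda>y. J j y $ p) x)"

lemma smooth_J: "smooth_on W (\<lambda>x. J i x $ p)"
  unfolding J_def using smooth_on_pderiv_at[OF smooth_\<phi>] by simp

lemma smooth_K: "smooth_on W (\<lambda>x. K i j x $ p)"
  unfolding K_def using smooth_on_pderiv_at[OF smooth_J] by simp

lemma K_commute: "x \<in> W \<Longrightarrow> K i j x = K j i x"
  using pderiv_at_commute[OF open_W _ smooth_\<phi>]
  by (simp add: K_def J_def vec_eq_iff)

lemma G_eq: "x \<in> W \<Longrightarrow> G x $ i $ j = bilin (G' (\<phi> x)) (J i x) (J j x)"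
  by (simp add: transform bilin_def J_def)

text \<open>Product rule and chain rule combined. It serves twice: with the metric of the second
  chart for \<open>B\<close>, and with its Christoffel symbols.\<close>

lemma pderiv_at_bilin_compose:
  assumes x: "x \<in> W" and B: "\<And>r s. (\<lambda>y. B y $ r $ s) differentiable (at (\<phi> x))"
    and XY: "\<And>r. (\<lambda>y. X y $ r) differentiable (at x)" "\<And>r. (\<lambda>y. Y y $ r) differentiable (at x)"
  shows "pderiv_at i (\<lambda>y. bilin (B (\<phi> y)) (X y) (Y y)) x =
    dbilin B (\<phi> x) (J i x) (X x) (Y x)
    + bilin (B (\<phi> x)) (\<chi> r. pderiv_at i (\<lambda>y. X y $ r) x) (Y x)
    + bilin (B (\<phi> x)) (X x) (\<chi> r. pderiv_at i (\<lambda>y. Y y $ r) x)"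
proof -
  note \<phi>d = smooth_on_differentiable[OF smooth_\<phi> x]
  have eq: "pderiv_at i (\<lambda>y. B (\<phi> y) $ r $ s) x = (\<Sum>p\<in>UNIV. pderiv_at p (\<lambda>y. B y $ r $ s) (\<phi> x) * J i x $ p)" for r s
    using differentiable_chain_pderiv(2)[OF \<phi>d B] by (simp add: J_def)
  have "bilin (\<chi> r s. pderiv_at i (\<lambda>y. B (\<phi> y) $ r $ s) x) (X x) (Y x) = dbilin B (\<phi> x) (J i x) (X x) (Y x)"
  proof -
    have "bilin (\<chi> r s. pderiv_at i (\<lambda>y. B (\<phi> y) $ r $ s) x) (X x) (Y x)
        = (\<Sum>r\<in>UNIV. \<Sum>s\<in>UNIV. \<Sum>p\<in>UNIV. J i x $ p * (pderiv_at p (\<lambda>y. B y $ r $ s) (\<phi> x) * X x $ r * Y x $ s))"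
      unfolding eq by (simp add: bilin_def sum_distrib_left sum_distrib_right mult_ac)
    also have "\<dots> = (\<Sum>p\<in>UNIV. \<Sum>r\<in>UNIV. \<Sum>s\<in>UNIV. J i x $ p * (pderiv_at p (\<lambda>y. B y $ r $ s) (\<phi> x) * X x $ r * Y x $ s))"
      by (subst (2) sum.swap) (subst sum.swap, rule refl)
    finally show ?thesis by (simp add: dbilin_def bilin_def sum_distrib_left)
  qed
  then show ?thesis
    using pderiv_at_bilin[of "\<lambda>y. B (\<phi> y)", OF differentiable_chain_pderiv(1)[OF \<phi>d B] XY] by simp
qed

lemma K_eq: "(\<chi> r. pderiv_at i (\<lambda>y. J j y $ r) x) = K i j x"
  by (simp add: K_def)

lemma J_differentiable: "x \<in> W \<Longrightarrow> (\<lambda>y. J i y $ r) differentiable (at x)"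
  by (rule smooth_on_differentiable[OF smooth_J])

lemma pderiv_G:
  assumes x: "x \<in> W"
  shows "pderiv_at i (\<lambda>y. G y $ j $ k) x = dbilin G' (\<phi> x) (J i x) (J j x) (J k x)
    + bilin (G' (\<phi> x)) (K i j x) (J k x) + bilin (G' (\<phi> x)) (J j x) (K i k x)"
proof -
  have "pderiv_at i (\<lambda>y. G y $ j $ k) x = pderiv_at i (\<lambda>y. bilin (G' (\<phi> y)) (J j y) (J k y)) x"
    by (rule pderiv_at_cong_open[OF open_W x G_eq])
  also have "\<dots> = dbilin G' (\<phi> x) (J i x) (J j x) (J k x)
    + bilin (G' (\<phi> x)) (K i j x) (J k x) + bilin (G' (\<phi> x)) (J j x) (K i k x)"
    unfolding K_eq[symmetric]
    by (rule pderiv_at_bilin_compose[OF x smooth_on_differentiable[OF d.smooth_G \<phi>_in[OF x]]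
          J_differentiable[OF x] J_differentiable[OF x]])
  finally show ?thesis .
qed

lemma det_J:
  assumes "x \<in> W"
  shows "det (G x) = (det (\<chi> i. J i x))\<^sup>2 * det (G' (\<phi> x))" and "det (\<chi> i. J i x) \<noteq> 0"
proof -
  let ?A = "\<chi> i. J i x"
  have "G x = ?A ** G' (\<phi> x) ** transpose ?A"
    by (simp add: vec_eq_iff matrix_congruence_component G_eq[OF assms])
  then show eq: "det (G x) = (det ?A)\<^sup>2 * det (G' (\<phi> x))"
    by (simp add: det_mul power2_eq_square)
  show "det ?A \<noteq> 0"
    using eq c.det_G[of x] W_sub assms by auto
qed

text \<open>The Jacobian is invertible, so the vectors \<open>J l x\<close> span, and the metric is
  definite. Vector identities can hence be tested against these vectors.\<close>

lemma orthogonal_J: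
  assumes x: "x \<in> W" and z: "\<And>l. bilin (G' (\<phi> x)) v (J l x) = 0"
  shows "v = 0"
proof -
  let ?A = "\<chi> i. J i x"
  have "?A *v (v v* G' (\<phi> x)) = 0"
    using z by (simp add: vec_eq_iff bilin_def matrix_vector_mult_def vector_matrix_mult_def
        sum_distrib_left sum_distrib_right mult_ac) (subst sum.swap, simp)
  then have "v v* G' (\<phi> x) = 0"
    using det_J(2)[OF x] by (metis det_nz_iff_inj inj_matrix_vector_mult invertible_det_nz matrix_left_invertible_ker invertible_left_inverse)
  then have "bilin (G' (\<phi> x)) v v = 0"
    by (simp add: bilin_inner dot_lmul_matrix[symmetric])
  then show ?thesis
    using d.pos_def_G[OF \<phi>_in[OF x]] by (force simp: pos_def_matrix_def)
qed

lemma bilin_commute': "x \<in> W \<Longrightarrow> bilin (G' (\<phi> x)) u v = bilin (G' (\<phi> x)) v u"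
  using bilin_commute d.G_commute \<phi>_in by blast

text \<open>The Koszul formula for fields with constant coefficients.\<close>

lemma bilin_christoffel_vec:
  assumes "y \<in> U'"
  shows "2 * bilin (G' y) (christoffel_vec G' y u v) w = dbilin G' y u v w + dbilin G' y v u w - dbilin G' y w u v"
proof -
  have "2 * bilin (G' y) (christoffel_vec G' y u v) w
      = (\<Sum>l\<in>UNIV. \<Sum>k\<in>UNIV. \<Sum>i\<in>UNIV. \<Sum>j\<in>UNIV. 2 * (u $ i * v $ j * w $ l) * (christoffel G' k i j y * G' y $ k $ l))"
    unfolding bilin_def by (subst sum.swap)
     (simp add: christoffel_vec_def christoffel_matrix_def bilin_def sum_distrib_left sum_distrib_right mult_ac)
  also have "\<dots> = (\<Sum>l\<in>UNIV. \<Sum>i\<in>UNIV. \<Sum>j\<in>UNIV. \<Sum>k\<in>UNIV. 2 * (u $ i * v $ j * w $ l) * (christoffel G' k i j y * G' y $ k $ l))"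
    by (rule sum.cong[OF refl], rule sum_rotate3)
  also have "\<dots> = (\<Sum>l\<in>UNIV. \<Sum>i\<in>UNIV. \<Sum>j\<in>UNIV. u $ i * v $ j * w $ l * (pderiv_at i (\<lambda>y. G' y $ j $ l) y + pderiv_at j (\<lambda>y. G' y $ i $ l) y
      - pderiv_at l (\<lambda>y. G' y $ i $ j) y))"
    unfolding sum_distrib_left[symmetric] d.christoffel_lowered[OF assms] by (simp add: sum_distrib_left mult.assoc)
  also have "\<dots> = (\<Sum>l\<in>UNIV. \<Sum>i\<in>UNIV. \<Sum>j\<in>UNIV. u $ i * v $ j * w $ l * pderiv_at i (\<lambda>y. G' y $ j $ l) y)
      + (\<Sum>l\<in>UNIV. \<Sum>i\<in>UNIV. \<Sum>j\<in>UNIV. u $ i * v $ j * w $ l * pderiv_at j (\<lambda>y. G' y $ i $ l) y)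
      - (\<Sum>l\<in>UNIV. \<Sum>i\<in>UNIV. \<Sum>j\<in>UNIV. u $ i * v $ j * w $ l * pderiv_at l (\<lambda>y. G' y $ i $ j) y)"
    by (simp add: distrib_left right_diff_distrib sum.distrib sum_subtractf)
  also have "(\<Sum>l\<in>UNIV. \<Sum>i\<in>UNIV. \<Sum>j\<in>UNIV. u $ i * v $ j * w $ l * pderiv_at i (\<lambda>y. G' y $ j $ l) y) = dbilin G' y u v w"
    unfolding dbilin_def bilin_def
    by (subst sum.swap, intro sum.cong refl, subst sum.swap) (simp add: sum_distrib_left mult_ac)
  also have "(\<Sum>l\<in>UNIV. \<Sum>i\<in>UNIV. \<Sum>j\<in>UNIV. u $ i * v $ j * w $ l * pderiv_at j (\<lambda>y. G' y $ i $ l) y)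
    = (\<Sum>j\<in>UNIV. \<Sum>i\<in>UNIV. \<Sum>l\<in>UNIV. u $ i * v $ j * w $ l * pderiv_at j (\<lambda>y. G' y $ i $ l) y)"
    by (subst (2) sum.swap) (subst sum.swap, intro sum.cong refl sum.swap)
  also have "\<dots> = dbilin G' y v u w"
    unfolding dbilin_def bilin_def by (simp add: sum_distrib_left mult_ac)
  also have "(\<Sum>l\<in>UNIV. \<Sum>i\<in>UNIV. \<Sum>j\<in>UNIV. u $ i * v $ j * w $ l * pderiv_at l (\<lambda>y. G' y $ i $ j) y) = dbilin G' y w u v"
    unfolding dbilin_def bilin_def by (simp add: sum_distrib_left mult_ac)
  finally show ?thesis .
qed

lemma christoffel_transform:
  assumes x: "x \<in> W"
  shows "(\<Sum>k\<in>UNIV. christoffel G k i j x *\<^sub>R J k x) = christoffel_vec G' (\<phi> x) (J i x) (J j x) + K i j x"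
proof -
  let ?h = "bilin (G' (\<phi> x))"
  have "?h ((\<Sum>k\<in>UNIV. christoffel G k i j x *\<^sub>R J k x) - (christoffel_vec G' (\<phi> x) (J i x) (J j x) + K i j x)) (J l x) = 0" for l
  proof -
    have "?h (\<Sum>k\<in>UNIV. christoffel G k i j x *\<^sub>R J k x) (J l x) = (\<Sum>k\<in>UNIV. christoffel G k i j x * G x $ k $ l)"
      by (simp add: bilin_sum_left G_eq[OF x])
    also have "2 * \<dots> = pderiv_at i (\<lambda>y. G y $ j $ l) x + pderiv_at j (\<lambda>y. G y $ i $ l) x
      - pderiv_at l (\<lambda>y. G y $ i $ j) x"
      using x W_sub by (subst c.christoffel_lowered) auto
    \<comment> \<open>Of the six terms containing \<open>K\<close>, symmetry of \<open>K\<close>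
      cancels four; the two with \<open>K i j x\<close> agree and produce the inhomogeneous term of
      the law.\<close>
    also have "\<dots> = 2 * ?h (christoffel_vec G' (\<phi> x) (J i x) (J j x)) (J l x) + 2 * ?h (K i j x) (J l x)"
      unfolding pderiv_G[OF x] bilin_christoffel_vec[OF \<phi>_in[OF x]]
      using K_commute[OF x, of i j] K_commute[OF x, of l i] K_commute[OF x, of l j] bilin_commute'[OF x]
      by simp
    finally show ?thesis
      by (simp add: linear_diff[OF linear_bilin_left] linear_add[OF linear_bilin_left])
  qed
  from orthogonal_J[OF x this] show ?thesis by simp
qed

lemma christoffel_matrix_differentiable:
  "y \<in> U' \<Longrightarrow> (\<lambda>y. christoffel_matrix G' m y $ r $ s) differentiable (at y)"
  using smooth_on_differentiable[OF d.smooth_christoffel] by (simp add: christoffel_matrix_def)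

text \<open>The law for the Christoffel symbols is differentiated in direction \<open>a\<close> and
  then used once more to rewrite the products of Christoffel symbols. The curvature is the
  antisymmetric part in \<open>a\<close> and \<open>i\<close>.\<close>

lemma curvature_transform:
  assumes x: "x \<in> W"
  shows "(\<Sum>l\<in>UNIV. curvature_op G a i j l x *\<^sub>R J l x) = curvature_vec G' (\<phi> x) (J a x) (J i x) (J j x)"
proof (subst vec_eq_iff, intro allI)
  fix m
  let ?B = "\<lambda>y. christoffel_matrix G' m y"
  define C where "C l i j = christoffel G l i j x" for l i j
  define D where "D a l i j = pderiv_at a (christoffel G l i j) x" for a l i j
  \<comment> \<open>The \<open>m\<close>-th component of the image of
    \<open>\<nabla>\<^sub>a \<nabla>\<^sub>i \<partial>\<^sub>j\<close> under the differential of
    \<phi>.\<close>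
  define T where "T a i j = (\<Sum>l\<in>UNIV. (D a l i j + (\<Sum>k\<in>UNIV. C l a k * C k i j)) * J l x $ m)" for a i j
  have law: "(\<Sum>k\<in>UNIV. christoffel G k i j y * J k y $ m) = bilin (?B (\<phi> y)) (J i y) (J j y) + K i j y $ m"
    if "y \<in> W" for i j y
    using arg_cong[OF christoffel_transform[OF that, of i j], of "\<lambda>v. v $ m"]
    by (simp add: sum_component christoffel_vec_def)
  have diff: "christoffel G k i j differentiable (at x)" for k i j
    using smooth_on_differentiable[OF c.smooth_christoffel] x W_sub by blast
  note Bd = christoffel_matrix_differentiable[OF \<phi>_in[OF x]]
  have D1: "(\<Sum>k\<in>UNIV. D a k i j * J k x $ m) + (\<Sum>k\<in>UNIV. C k i j * K a k x $ m)
      = dbilin ?B (\<phi> x) (J a x) (J i x) (J j x) + bilin (?B (\<phi> x)) (K a i x) (J j x)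
        + bilin (?B (\<phi> x)) (J i x) (K a j x) + pderiv_at a (\<lambda>y. K i j y $ m) x" for a i j
  proof -
    have "(\<Sum>k\<in>UNIV. D a k i j * J k x $ m) + (\<Sum>k\<in>UNIV. C k i j * K a k x $ m)
        = pderiv_at a (\<lambda>y. \<Sum>k\<in>UNIV. christoffel G k i j y * J k y $ m) x"
      by (simp add: pderiv_at_sum pderiv_at_mult differentiable_mult diff J_differentiable[OF x] K_def
          D_def C_def sum.distrib)
    also have "\<dots> = pderiv_at a (\<lambda>y. bilin (?B (\<phi> y)) (J i y) (J j y) + K i j y $ m) x"
      by (rule pderiv_at_cong_open[OF open_W x law])
    also have "\<dots> = pderiv_at a (\<lambda>y. bilin (?B (\<phi> y)) (J i y) (J j y)) x + pderiv_at a (\<lambda>y. K i j y $ m) x"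
      by (intro pderiv_at_add differentiable_bilin smooth_on_differentiable[OF smooth_J x] smooth_on_differentiable[OF smooth_K x]
          differentiable_chain_pderiv(1)[OF smooth_on_differentiable[OF smooth_\<phi> x] Bd])
    also have "pderiv_at a (\<lambda>y. bilin (?B (\<phi> y)) (J i y) (J j y)) x = dbilin ?B (\<phi> x) (J a x) (J i x) (J j x) + bilin (?B (\<phi> x)) (K a i x) (J j x)
        + bilin (?B (\<phi> x)) (J i x) (K a j x)"
      unfolding K_eq[symmetric]
      by (rule pderiv_at_bilin_compose[OF x Bd J_differentiable[OF x] J_differentiable[OF x]])
    finally show ?thesis .
  qed
  \<comment> \<open>The last sum also stands on the left of \<open>D1\<close>, so it drops out when
    the two are combined into \<open>T a i j\<close>.\<close>
  have D2: "(\<Sum>l\<in>UNIV. (\<Sum>k\<in>UNIV. C l a k * C k i j) * J l x $ m)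
      = bilin (?B (\<phi> x)) (J a x) (christoffel_vec G' (\<phi> x) (J i x) (J j x) + K i j x)
        + (\<Sum>k\<in>UNIV. C k i j * K a k x $ m)" for a i j
  proof -
    have "(\<Sum>l\<in>UNIV. (\<Sum>k\<in>UNIV. C l a k * C k i j) * J l x $ m)
        = (\<Sum>k\<in>UNIV. C k i j * (\<Sum>l\<in>UNIV. C l a k * J l x $ m))"
      unfolding sum_distrib_left sum_distrib_right by (subst sum.swap) (simp add: mult_ac)
    also have "\<dots> = (\<Sum>k\<in>UNIV. C k i j * bilin (?B (\<phi> x)) (J a x) (J k x)) + (\<Sum>k\<in>UNIV. C k i j * K a k x $ m)"
      unfolding C_def law[OF x] by (simp add: distrib_left sum.distrib)
    also have "(\<Sum>k\<in>UNIV. C k i j * bilin (?B (\<phi> x)) (J a x) (J k x))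
        = bilin (?B (\<phi> x)) (J a x) (christoffel_vec G' (\<phi> x) (J i x) (J j x) + K i j x)"
      by (simp add: christoffel_transform[OF x, symmetric] bilin_sum_right C_def)
    finally show ?thesis .
  qed
  have L: "pderiv_at a (\<lambda>y. K i j y $ m) x = pderiv_at i (\<lambda>y. K a j y $ m) x" for a i
    unfolding K_def using pderiv_at_commute[OF open_W x smooth_J] by simp
  have T: "T a i j = dbilin ?B (\<phi> x) (J a x) (J i x) (J j x) + bilin (?B (\<phi> x)) (K a i x) (J j x)
        + bilin (?B (\<phi> x)) (J i x) (K a j x) + pderiv_at a (\<lambda>y. K i j y $ m) x
        + bilin (?B (\<phi> x)) (J a x) (christoffel_vec G' (\<phi> x) (J i x) (J j x)) + bilin (?B (\<phi> x)) (J a x) (K i j x)" for a i j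
    using D1[of a i j] D2[of a i j] by (simp add: T_def distrib_right sum.distrib bilin_add_right)
  \<comment> \<open>In \<open>T a i j\<close> the terms containing \<open>K\<close> are together symmetric in \<open>a\<close> and \<open>i\<close>.\<close>
  have "(\<Sum>l\<in>UNIV. curvature_op G a i j l x *\<^sub>R J l x) $ m = T a i j - T i a j"
    unfolding T_def sum_subtractf[symmetric] sum_component
    by (intro sum.cong refl) (simp add: curvature_op_def C_def D_def sum_subtractf algebra_simps)
  also have "\<dots> = curvature_vec G' (\<phi> x) (J a x) (J i x) (J j x) $ m"
    unfolding T curvature_vec_def using L[of a i] K_commute[OF x, of a i] by simp
  finally show "(\<Sum>l\<in>UNIV. curvature_op G a i j l x *\<^sub>R J l x) $ m = curvature_vec G' (\<phi> x) (J a x) (J i x) (J j x) $ m" .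
qed

end

section \<open>The Einstein-Lovelock contraction\<close>

text \<open>
  \<open>df11 B\<close> times the double form whose Hodge star is \<open>T\<^bsub>2k\<^esub>\<close>. It has top degree, so its value on
  a basis determines \<open>\<langle>T\<^bsub>2k\<^esub>, B\<rangle>\<close> without choosing an orthonormal frame.
\<close>

definition lovelock_form ::
    "nat \<Rightarrow> (real^'n \<Rightarrow> real^'n^'n) \<Rightarrow> real^'n::finite \<Rightarrow> (real^'n \<Rightarrow> real^'n \<Rightarrow> real) \<Rightarrow> (real^'n) double_form" where
  "lovelock_form k G x B = (let m = CARD('n) - 2 * k - 1 in
     df_mult (df11 B) (df_scale (1 / fact m)
       (df_mult (df_power (df11 (bilin (G x))) m) (df_power (df22 (riemann G x)) k))))"

lemma df_mult_sum_left:
  "df_mult (\<lambda>xs ys. \<Sum>i\<in>I. c i * \<omega> i xs ys) \<eta> xs ys = (\<Sum>i\<in>I. c i * df_mult (\<omega> i) \<eta> xs ys)"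
proof -
  have "df_mult (\<lambda>xs ys. \<Sum>i\<in>I. c i * \<omega> i xs ys) \<eta> xs ys = (\<Sum>P\<in>Pow {..<length xs}. \<Sum>Q\<in>Pow {..<length ys}. \<Sum>i\<in>I.
      c i * (shuffle_sign (length xs) P * shuffle_sign (length ys) Q * \<omega> i (nths xs P) (nths ys Q) * \<eta> (nths xs (- P)) (nths ys (- Q))))"
    by (simp add: df_mult_def sum_distrib_left sum_distrib_right mult_ac)
  also have "\<dots> = (\<Sum>i\<in>I. \<Sum>P\<in>Pow {..<length xs}. \<Sum>Q\<in>Pow {..<length ys}.
      c i * (shuffle_sign (length xs) P * shuffle_sign (length ys) Q * \<omega> i (nths xs P) (nths ys Q) * \<eta> (nths xs (- P)) (nths ys (- Q))))"
    by (rule sum_rotate3[symmetric])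
  finally show ?thesis by (simp add: df_mult_def sum_distrib_left)
qed

lemma df11_sum: "df11 (\<lambda>u v. \<Sum>i\<in>I. c i * B i u v) = (\<lambda>xs ys. \<Sum>i\<in>I. c i * df11 (B i) xs ys)"
  by (auto simp: df11_def fun_eq_iff split: list.split)

lemma lovelock_form_sum:
  "lovelock_form k G x (\<lambda>u v. \<Sum>i\<in>I. c i * B i u v) xs ys = (\<Sum>i\<in>I. c i * lovelock_form k G x (B i) xs ys)"
  by (simp add: lovelock_form_def Let_def df11_sum df_mult_sum_left)

text \<open>Linearity in \<open>B\<close> separates the components of the Hessian from factors that
  depend on the metric alone; these factors become the coefficients of the operator.\<close>

lemma lovelock_form_components:
  "lovelock_form k G x (\<lambda>u v. \<Sum>i\<in>UNIV. \<Sum>j\<in>UNIV. u $ i * v $ j * C i j) xs ys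
    = (\<Sum>i\<in>UNIV. \<Sum>j\<in>UNIV. C i j * lovelock_form k G x (\<lambda>u v. u $ i * v $ j) xs ys)"
proof -
  have "(\<lambda>u v. \<Sum>i\<in>UNIV. \<Sum>j\<in>UNIV. u $ i * v $ j * C i j)
      = (\<lambda>u v. \<Sum>p\<in>UNIV\<times>UNIV. C (fst p) (snd p) * (u $ fst p * v $ snd p))"
    unfolding sum.cartesian_product by (simp add: case_prod_beta mult_ac)
  then have "lovelock_form k G x (\<lambda>u v. \<Sum>i\<in>UNIV. \<Sum>j\<in>UNIV. u $ i * v $ j * C i j) xs ys
      = (\<Sum>p\<in>UNIV\<times>UNIV. C (fst p) (snd p) * lovelock_form k G x (\<lambda>u v. u $ fst p * v $ snd p) xs ys)"
    by (simp only: lovelock_form_sum)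
  then show ?thesis
    unfolding sum.cartesian_product by (simp add: case_prod_beta)
qed

lemma hessian_components:
  "hessian G F x = (\<lambda>u v. \<Sum>i\<in>UNIV. \<Sum>j\<in>UNIV. u $ i * v $ j *
     (pderiv_at i (pderiv_at j F) x - (\<Sum>k\<in>UNIV. christoffel G k i j x * pderiv_at k F x)))"
  by (simp add: fun_eq_iff hessian_def)

lemma hessian_bilin:
  "hessian G F x u v = bilin (\<chi> i j. pderiv_at i (pderiv_at j F) x) u v
     - (\<Sum>k\<in>UNIV. pderiv_at k F x * christoffel_vec G x u v $ k)"
proof -
  have "(\<Sum>i\<in>UNIV. \<Sum>j\<in>UNIV. \<Sum>k\<in>UNIV. u $ i * v $ j * (christoffel G k i j x * pderiv_at k F x))
    = (\<Sum>k\<in>UNIV. \<Sum>i\<in>UNIV. \<Sum>j\<in>UNIV. u $ i * v $ j * (christoffel G k i j x * pderiv_at k F x))"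
    by (rule sum_rotate3[symmetric])
  then show ?thesis
    by (simp add: hessian_def bilin_def christoffel_vec_def christoffel_matrix_def right_diff_distrib
        sum_subtractf sum_distrib_left mult_ac)
qed

lemma linear_hessian_left: "linear (\<lambda>u. hessian G F x u v)"
  and linear_hessian_right: "linear (hessian G F x u)"
  unfolding hessian_def linear_iff
  by (simp_all add: distrib_left distrib_right sum.distrib sum_distrib_left mult_ac)

context coordinate_metric
begin

lemma df_alternating_lovelock_form:
  assumes "x \<in> U" "\<And>y. linear (\<lambda>x. B x y)" "\<And>x. linear (B x)"
  shows "df_alternating (lovelock_form k G x B)"
  unfolding lovelock_form_def Let_def using assms
  by (intro df_alternating_mult df_alternating_scale df_alternating_power df_alternating_df11
      df_alternating_riemann linear_bilin_left linear_bilin_right)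

lemma smooth_lovelock_form: "smooth_on U (\<lambda>x. lovelock_form k G x B xs ys)"
  unfolding lovelock_form_def Let_def df_scale_def
  by (intro smooth_on_df_mult smooth_on_mult smooth_on_df_power smooth_on_df11 smooth_on_df22
      smooth_on_const smooth_bilin smooth_riemann open_U)

lemma inner11_einstein_lovelock:
  fixes es :: "'n list"
  assumes x: "x \<in> U" and es: "distinct es" "set es = UNIV"
    and B: "\<And>y. linear (\<lambda>x. B x y)" "\<And>x. linear (B x)"
  shows "inner11 (bilin (G x)) (einstein_lovelock k G x) B
    = lovelock_form k G x B (map (\<lambda>j. axis j 1) es) (map (\<lambda>j. axis j 1) es) / det (G x)"
proof -
  let ?e = "frame (bilin (G x))"
  have on: "orthonormal_frame (bilin (G x)) ?e"
    by (rule orthonormal_frame_frame[OF pos_def_G[OF x]])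
  obtain P where P: "?e = map (\<lambda>k. \<Sum>j\<in>UNIV. P $ k $ j *\<^sub>R axis j 1) es" "(det P)\<^sup>2 * det (G x) = 1"
    using orthonormal_frame_coordinates[OF on es] .
  have "inner11 (bilin (G x)) (einstein_lovelock k G x) B = lovelock_form k G x B ?e ?e"
    unfolding einstein_lovelock_def Let_def inner11_df_star[OF on] lovelock_form_def ..
  also have "\<dots> = (det P)\<^sup>2 * lovelock_form k G x B (map (\<lambda>j. axis j 1) es) (map (\<lambda>j. axis j 1) es)"
    unfolding P(1) by (rule df_alternating_det[OF df_alternating_lovelock_form[OF x B] es])
  also have "(det P)\<^sup>2 = 1 / det (G x)"
    using P(2) det_G[OF x] by (simp add: field_simps)
  finally show ?thesis by simp
qed

text \<open>The vector \<open>v\<close> is the metric dual of \<xi>. If it vanished, \<xi> would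
  annihilate the frame, and the coordinate matrix of the frame is invertible, so \<xi> would be
  zero.\<close>

lemma symbol_value:
  fixes \<xi> :: "real^'n"
  assumes x: "x \<in> U" and "\<xi> \<noteq> 0"
  obtains v where "v \<noteq> 0"
    "inner11 (bilin (G x)) (einstein_lovelock k G x) (\<lambda>u w. (\<xi> \<bullet> u) * (\<xi> \<bullet> w)) = einstein_lovelock k G x v v"
proof -
  let ?e = "frame (bilin (G x))"
  have on: "orthonormal_frame (bilin (G x)) ?e"
    by (rule orthonormal_frame_frame[OF pos_def_G[OF x]])
  obtain es :: "'n list" where es: "distinct es" "set es = UNIV"
    using finite_distinct_list[OF finite] by blast
  obtain P where P: "?e = map (\<lambda>k. \<Sum>j\<in>UNIV. P $ k $ j *\<^sub>R axis j 1) es" "(det P)\<^sup>2 * det (G x) = 1"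
    using orthonormal_frame_coordinates[OF on es] .
  define v where "v = (\<Sum>a<CARD('n). (\<xi> \<bullet> (?e ! a)) *\<^sub>R ?e ! a)"
  note dual = df_star_dual_vector[where \<xi> = \<xi>, OF on linear_bilin_left, folded v_def]
  have "v \<noteq> 0"
  proof
    assume "v = 0"
    then have z: "\<xi> \<bullet> (?e ! i) = 0" if "i < CARD('n)" for i
      using dual(2)[OF that] linear_0[OF linear_bilin_left] by metis
    have "\<xi> \<bullet> u = 0" if "u \<in> set ?e" for u
      using that z on by (metis in_set_conv_nth orthonormal_frame_def)
    then have "\<xi> \<bullet> (\<Sum>j\<in>UNIV. P $ k $ j *\<^sub>R axis j 1) = 0" for k
      unfolding P(1) using es(2) by auto
    then have "P *v \<xi> = 0"
      by (simp add: vec_eq_iff inner_sum_right inner_axis matrix_vector_mult_def)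
    moreover have "det P \<noteq> 0" using P(2) by auto
    ultimately have "\<xi> = 0"
      by (metis invertible_det_nz invertible_left_inverse matrix_left_invertible_ker)
    with assms(2) show False ..
  qed
  moreover have "inner11 (bilin (G x)) (einstein_lovelock k G x) (\<lambda>u w. (\<xi> \<bullet> u) * (\<xi> \<bullet> w)) = einstein_lovelock k G x v v"
    unfolding einstein_lovelock_def Let_def inner11_df_star[OF on] dual(1) ..
  ultimately show ?thesis using that by blast
qed

end

lemma linear_curvature_vec:
  "linear (\<lambda>u. curvature_vec G y u v z)" "linear (\<lambda>v. curvature_vec G y u v z)" "linear (\<lambda>z. curvature_vec G y u v z)"
  by (simp_all add: linear_iff vec_eq_iff curvature_vec_components distrib_left distrib_right sum.distrib
      sum_distrib_left mult_ac)

context coordinate_change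
begin

text \<open>The differential of \<phi> at \<open>x\<close>.\<close>

definition T :: "real^'n \<Rightarrow> real^'n \<Rightarrow> real^'n" where
  "T x u = (\<Sum>i\<in>UNIV. u $ i *\<^sub>R J i x)"

lemma bilin_T: "x \<in> W \<Longrightarrow> bilin (G x) u v = bilin (G' (\<phi> x)) (T x u) (T x v)"
  unfolding T_def bilin_sum_left unfolding bilin_sum_right
  by (simp add: bilin_def[of "G x"] G_eq sum_distrib_left mult_ac)

lemma T_sum: "T x (\<Sum>i\<in>I. c i *\<^sub>R a i) = (\<Sum>i\<in>I. c i *\<^sub>R T x (a i))"
proof -
  have "T x (\<Sum>i\<in>I. c i *\<^sub>R a i) = (\<Sum>k\<in>UNIV. \<Sum>i\<in>I. (c i * a i $ k) *\<^sub>R J k x)"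
    by (simp add: T_def sum_component scaleR_sum_left)
  also have "\<dots> = (\<Sum>i\<in>I. \<Sum>k\<in>UNIV. (c i * a i $ k) *\<^sub>R J k x)"
    by (rule sum.swap)
  finally show ?thesis by (simp add: T_def scaleR_sum_right)
qed

lemma riemann_T:
  assumes x: "x \<in> W"
  shows "riemann G x u v w z = riemann G' (\<phi> x) (T x u) (T x v) (T x w) (T x z)"
proof -
  let ?R = "curvature_vec G' (\<phi> x)"
  \<comment> \<open>The nested form lets \<open>T_sum\<close> carry \<open>T x\<close> inwards to
    the basis vectors, where \<open>curvature_transform\<close> applies.\<close>
  have "curvature_vec G x u v z = (\<Sum>i\<in>UNIV. u $ i *\<^sub>R (\<Sum>j\<in>UNIV. v $ j *\<^sub>R (\<Sum>k\<in>UNIV. z $ k *\<^sub>R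
      (\<Sum>l\<in>UNIV. curvature_op G i j k l x *\<^sub>R axis l 1))))"
    by (simp add: vec_eq_iff curvature_vec_components sum_component axis_def sum_distrib_left mult_ac
        if_distrib[of "\<lambda>t. t * _"] if_distrib[of "\<lambda>t. _ * t"] cong: if_cong)
  moreover have "T x (axis l 1) = J l x" for l
    by (simp add: T_def axis_def if_distrib[of "\<lambda>t. t *\<^sub>R _"] cong: if_cong)
  ultimately have "T x (curvature_vec G x u v z) = (\<Sum>i\<in>UNIV. u $ i *\<^sub>R (\<Sum>j\<in>UNIV. v $ j *\<^sub>R (\<Sum>k\<in>UNIV. z $ k *\<^sub>R
      ?R (J i x) (J j x) (J k x))))"
    by (simp only: T_sum curvature_transform[OF x, symmetric])
  also have "\<dots> = ?R (T x u) (T x v) (T x z)"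
    unfolding T_def linear_sum[OF linear_curvature_vec(1)] linear_scale[OF linear_curvature_vec(1)]
    unfolding linear_sum[OF linear_curvature_vec(2)] linear_scale[OF linear_curvature_vec(2)]
    unfolding linear_sum[OF linear_curvature_vec(3)] linear_scale[OF linear_curvature_vec(3)] ..
  finally show ?thesis
    unfolding riemann_curvature_vec bilin_T[OF x] by simp
qed

lemma hessian_T:
  assumes x: "x \<in> W" and F': "smooth_on U' F'" and F: "\<And>y. y \<in> W \<Longrightarrow> F y = F' (\<phi> y)"
  shows "hessian G F x u v = hessian G' F' (\<phi> x) (T x u) (T x v)"
proof -
  note \<phi>d = smooth_on_differentiable[OF smooth_\<phi>]
  have d1: "pderiv_at j F y = (\<Sum>p\<in>UNIV. pderiv_at p F' (\<phi> y) * J j y $ p)" if "y \<in> W" for y j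
  proof -
    have "pderiv_at j F y = pderiv_at j (\<lambda>y. F' (\<phi> y)) y"
      by (rule pderiv_at_cong_open[OF open_W that F])
    also have "\<dots> = (\<Sum>p\<in>UNIV. pderiv_at p F' (\<phi> y) * J j y $ p)"
      using differentiable_chain_pderiv(2)[OF \<phi>d[OF that] smooth_on_differentiable[OF F' \<phi>_in[OF that]]]
      by (simp add: J_def)
    finally show ?thesis .
  qed
  note chain = differentiable_chain_pderiv[OF \<phi>d[OF x] smooth_on_differentiable[OF smooth_on_pderiv_at[OF F'] \<phi>_in[OF x]]]
  have d2: "pderiv_at i (pderiv_at j F) x =
      bilin (\<chi> i j. pderiv_at i (pderiv_at j F') (\<phi> x)) (J i x) (J j x) + (\<Sum>p\<in>UNIV. pderiv_at p F' (\<phi> x) * K i j x $ p)"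
    for i j
  proof -
    have "pderiv_at i (pderiv_at j F) x = pderiv_at i (\<lambda>y. \<Sum>p\<in>UNIV. pderiv_at p F' (\<phi> y) * J j y $ p) x"
      by (rule pderiv_at_cong_open[OF open_W x d1])
    also have "\<dots> = (\<Sum>p\<in>UNIV. pderiv_at p F' (\<phi> x) * K i j x $ p
        + (\<Sum>q\<in>UNIV. pderiv_at q (pderiv_at p F') (\<phi> x) * J i x $ q) * J j x $ p)"
      by (simp add: pderiv_at_sum pderiv_at_mult differentiable_mult chain(1) J_differentiable[OF x] K_def)
         (simp add: chain(2) J_def)
    also have "\<dots> = (\<Sum>p\<in>UNIV. \<Sum>q\<in>UNIV. pderiv_at q (pderiv_at p F') (\<phi> x) * J i x $ q * J j x $ p)
        + (\<Sum>p\<in>UNIV. pderiv_at p F' (\<phi> x) * K i j x $ p)"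
      by (simp add: sum.distrib sum_distrib_right)
    also have "(\<Sum>p\<in>UNIV. \<Sum>q\<in>UNIV. pderiv_at q (pderiv_at p F') (\<phi> x) * J i x $ q * J j x $ p)
        = bilin (\<chi> i j. pderiv_at i (pderiv_at j F') (\<phi> x)) (J i x) (J j x)"
      unfolding bilin_def by (subst sum.swap) simp
    finally show ?thesis .
  qed
  have d3: "(\<Sum>k\<in>UNIV. christoffel G k i j x * pderiv_at k F x)
      = (\<Sum>p\<in>UNIV. pderiv_at p F' (\<phi> x) * (christoffel_vec G' (\<phi> x) (J i x) (J j x) + K i j x) $ p)" for i j
    unfolding christoffel_transform[OF x, symmetric] sum_component d1[OF x] sum_distrib_left
    by (subst sum.swap) (simp add: mult_ac)
  \<comment> \<open>The terms with \<open>K\<close> from the second derivatives in \<open>d2\<close>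
    cancel against the inhomogeneous term of the Christoffel law in \<open>d3\<close>; this
    cancellation makes the Hessian a tensor.\<close>
  have basis: "pderiv_at i (pderiv_at j F) x - (\<Sum>k\<in>UNIV. christoffel G k i j x * pderiv_at k F x)
      = hessian G' F' (\<phi> x) (J i x) (J j x)" for i j
    unfolding d2 d3 hessian_bilin by (simp add: distrib_left sum.distrib)
  show ?thesis
    unfolding T_def hessian_components[of G] basis
      linear_sum[OF linear_hessian_left] linear_scale[OF linear_hessian_left]
    unfolding linear_sum[OF linear_hessian_right] linear_scale[OF linear_hessian_right]
    by (simp add: sum_distrib_left mult_ac)
qed

lemma lovelock_form_T:
  assumes x: "x \<in> W" and "\<And>u v. B u v = B' (T x u) (T x v)"
  shows "lovelock_form k G' (\<phi> x) B' (map (T x) xs) (map (T x) ys) = lovelock_form k G x B xs ys"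
proof -
  have 1: "df11 B' (map (T x) xs) (map (T x) ys) = df11 B xs ys" for xs ys
    by (simp add: df11_map assms(2)[symmetric])
  have 2: "df11 (bilin (G' (\<phi> x))) (map (T x) xs) (map (T x) ys) = df11 (bilin (G x)) xs ys" for xs ys
    by (simp add: df11_map bilin_T[OF x, symmetric])
  have 3: "df22 (riemann G' (\<phi> x)) (map (T x) xs) (map (T x) ys) = df22 (riemann G x) xs ys" for xs ys
    by (simp add: df22_map riemann_T[OF x, symmetric])
  show ?thesis
    unfolding lovelock_form_def Let_def
    by (intro df_mult_map 1, unfold df_scale_def) (intro arg_cong[where f = "(*) _"] df_mult_map df_power_map 2 3)
qed

text \<open>The left side lives in the second chart, the right side in the first. \<open>T x\<close>
  sends the coordinate basis to the rows of the Jacobian, and the resulting squared determinant is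
  the same factor by which \<open>det (G x)\<close> exceeds
  \<open>det (G' (\<phi> x))\<close>.\<close>

lemma inner11_einstein_lovelock_transform:
  fixes es :: "'n list"
  assumes x: "x \<in> W" and F': "smooth_on U' F'" and F: "\<And>y. y \<in> W \<Longrightarrow> F y = F' (\<phi> y)"
    and es: "distinct es" "set es = UNIV"
  shows "inner11 (bilin (G' (\<phi> x))) (einstein_lovelock k G' (\<phi> x)) (hessian G' F' (\<phi> x))
    = lovelock_form k G x (hessian G F x) (map (\<lambda>j. axis j 1) es) (map (\<lambda>j. axis j 1) es) / det (G x)"
proof -
  let ?b = "map (\<lambda>j. axis j 1) es :: (real^'n) list" and ?A = "\<chi> i. J i x"
  let ?\<Psi>' = "lovelock_form k G' (\<phi> x) (hessian G' F' (\<phi> x))"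
  note bl = linear_hessian_left[of G' F' "\<phi> x"] linear_hessian_right[of G' F' "\<phi> x"]
  have "T x (axis l 1) = (\<Sum>j\<in>UNIV. ?A $ l $ j *\<^sub>R axis j 1)" for l
    using basis_expansion[of "J l x"]
    by (simp add: T_def axis_def if_distrib[of "\<lambda>t. t *\<^sub>R _"] scalar_mult_eq_scaleR cong: if_cong)
  then have b: "map (T x) ?b = map (\<lambda>l. \<Sum>j\<in>UNIV. ?A $ l $ j *\<^sub>R axis j 1) es"
    by simp
  have "lovelock_form k G x (hessian G F x) ?b ?b = ?\<Psi>' (map (T x) ?b) (map (T x) ?b)"
    by (rule lovelock_form_T[where B = "hessian G F x" and B' = "hessian G' F' (\<phi> x)",
          OF x hessian_T[OF x F' F], symmetric])
  also have "\<dots> = (det ?A)\<^sup>2 * ?\<Psi>' ?b ?b"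
    unfolding b by (rule df_alternating_det[OF d.df_alternating_lovelock_form[OF \<phi>_in[OF x] bl] es])
  finally show ?thesis
    unfolding d.inner11_einstein_lovelock[OF \<phi>_in[OF x] es bl] det_J(1)[OF x]
    using det_J(2)[OF x] by simp
qed

end

section \<open>Ellipticity\<close>

locale riemannian_manifold_charts =
  fixes X :: "'a topology" and A :: "('a, 'n::finite) chart set" and g :: "('a, 'n) metric"
  assumes manifold: "riemannian_manifold X A g"
begin

lemma chart_homeomorphic:
  "c \<in> A \<Longrightarrow> homeomorphic_map (subtopology X (fst c)) (top_of_set (chart_image c)) (snd c)"
  and chart_openin: "c \<in> A \<Longrightarrow> openin X (fst c)"
  and open_chart_image: "c \<in> A \<Longrightarrow> open (chart_image c)"
  using manifold by (auto simp: riemannian_manifold_def smooth_manifold_def)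

lemma topspace_chart: "c \<in> A \<Longrightarrow> topspace (subtopology X (fst c)) = fst c"
  by (metis Int_absorb1 openin_subset chart_openin topspace_subtopology)

lemma chart_inj: "c \<in> A \<Longrightarrow> inj_on (snd c) (fst c)"
  using chart_homeomorphic topspace_chart by (metis homeomorphic_imp_injective_map)

lemma chart_inv_in: "x \<in> chart_image c \<Longrightarrow> chart_inv c x \<in> fst c"
  by (simp add: chart_image_def chart_inv_def inv_into_into)

lemma chart_chart_inv: "x \<in> chart_image c \<Longrightarrow> snd c (chart_inv c x) = x"
  by (simp add: chart_image_def chart_inv_def f_inv_into_f)

lemma chart_inv_chart: "c \<in> A \<Longrightarrow> p \<in> fst c \<Longrightarrow> chart_inv c (snd c p) = p"
  by (simp add: chart_inv_def chart_inj)

lemma open_overlap: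
  assumes "c \<in> A" "d \<in> A" shows "open (snd c ` (fst c \<inter> fst d))"
proof -
  have "openin (subtopology X (fst c)) (fst c \<inter> fst d)"
    using chart_openin[OF assms(2)] by (auto simp: openin_subtopology)
  then have "openin (top_of_set (chart_image c)) (snd c ` (fst c \<inter> fst d))"
    using homeomorphic_imp_open_map[OF chart_homeomorphic[OF assms(1)]] by (simp add: open_map_def)
  then show ?thesis
    using open_chart_image[OF assms(1)] openin_open_eq by blast
qed

lemma coordinate_metric_chart:
  assumes "c \<in> A" shows "coordinate_metric (g c) (chart_image c)"
  using manifold assms open_chart_image
  by unfold_locales (auto simp: riemannian_manifold_def riemannian_metric_def pos_def_matrix_def)

lemma coordinate_change_charts:
  assumes "c \<in> A" "d \<in> A"
  shows "coordinate_change (g c) (g d) (chart_image c) (chart_image d) (snd c ` (fst c \<inter> fst d)) (transition c d)"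
proof -
  interpret c: coordinate_metric "g c" "chart_image c" by (rule coordinate_metric_chart[OF assms(1)])
  interpret d: coordinate_metric "g d" "chart_image d" by (rule coordinate_metric_chart[OF assms(2)])
  show ?thesis
  proof
    show "open (snd c ` (fst c \<inter> fst d))" by (rule open_overlap[OF assms])
    show "snd c ` (fst c \<inter> fst d) \<subseteq> chart_image c" by (auto simp: chart_image_def)
    show "transition c d x \<in> chart_image d" if "x \<in> snd c ` (fst c \<inter> fst d)" for x
      using that chart_inv_chart[OF assms(1)] by (auto simp: transition_def chart_image_def)
    show "smooth_on (snd c ` (fst c \<inter> fst d)) (\<lambda>x. transition c d x $ p)" for p
      using manifold assms by (simp add: riemannian_manifold_def smooth_manifold_def)
    show "g c x $ i $ j = (\<Sum>k\<in>UNIV. \<Sum>l\<in>UNIV. g d (transition c d x) $ k $ l *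
      pderiv_at i (\<lambda>y. transition c d y $ k) x * pderiv_at j (\<lambda>y. transition c d y $ l) x)"
      if "x \<in> snd c ` (fst c \<inter> fst d)" for x i j
      using manifold assms that unfolding riemannian_manifold_def riemannian_metric_def by blast
  qed
qed

lemma chart_at:
  assumes "c \<in> A" "p \<in> fst c" shows "chart_at A p \<in> A" "p \<in> fst (chart_at A p)"
  using someI[of "\<lambda>c. c \<in> A \<and> p \<in> fst c" c] assms by (auto simp: chart_at_def)

text \<open>The chart \<open>c\<close> is prescribed here and stays fixed as \<open>x\<close>
  varies, while the operator is evaluated in the chart that \<open>chart_at\<close> selects at each
  point.\<close>

lemma lovelock_operator_in_chart:
  fixes es :: "'n list"
  assumes c: "c \<in> A" and x: "x \<in> chart_image c" and f: "smooth_fun A f"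
    and es: "distinct es" "set es = UNIV"
  shows "lovelock_operator A g k f (chart_inv c x) =
    - (lovelock_form k (g c) x (hessian (g c) (f \<circ> chart_inv c) x)
        (map (\<lambda>j. axis j 1) es) (map (\<lambda>j. axis j 1) es) / det (g c x))"
proof -
  let ?p = "chart_inv c x"
  define d where "d = chart_at A ?p"
  have d: "d \<in> A" "?p \<in> fst d"
    using chart_at[OF c chart_inv_in[OF x]] by (auto simp: d_def)
  interpret coordinate_change "g c" "g d" "chart_image c" "chart_image d" "snd c ` (fst c \<inter> fst d)" "transition c d"
    by (rule coordinate_change_charts[OF c d(1)])
  have xW: "x \<in> snd c ` (fst c \<inter> fst d)"
    using chart_chart_inv[OF x] chart_inv_in[OF x] d(2) by (metis IntI image_eqI)
  have F: "(f \<circ> chart_inv c) y = (f \<circ> chart_inv d) (transition c d y)" if "y \<in> snd c ` (fst c \<inter> fst d)" for y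
    using that chart_inv_chart[OF c] chart_inv_chart[OF d(1)] by (auto simp: transition_def)
  have "smooth_on (chart_image d) (f \<circ> chart_inv d)"
    using f d(1) by (simp add: smooth_fun_def)
  from inner11_einstein_lovelock_transform[OF xW this F es]
  show ?thesis
    by (simp add: lovelock_operator_def Let_def d_def[symmetric] transition_def comp_def)
qed

end

theorem proposition3p9:
  fixes X :: "'a topology"
    and A :: "('a, 'n::finite) chart set"
    and g :: "('a, 'n) metric"
    and k :: nat
  assumes "riemannian_manifold X A g"
    and "2 * k < CARD('n)"
    and "lovelock_positive_definite A g k \<or> lovelock_negative_definite A g k"
  shows "elliptic_operator A (lovelock_operator A g k)"
  unfolding elliptic_operator_def
proof
  fix c assume c: "c \<in> A"
  interpret riemannian_manifold_charts X A g by unfold_locales (rule assms(1))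
  interpret coordinate_metric "g c" "chart_image c" by (rule coordinate_metric_chart[OF c])
  obtain es :: "'n list" where es: "distinct es" "set es = UNIV"
    using finite_distinct_list[OF finite] by blast
  define bs :: "(real^'n) list" where "bs = map (\<lambda>j. axis j 1) es"
  define w where "w i j x = lovelock_form k (g c) x (\<lambda>u v. u $ i * v $ j) bs bs" for i j x
  define a where "a i j x = - (w i j x / det (g c x))" for i j x
  define b where "b l x = (\<Sum>i\<in>UNIV. \<Sum>j\<in>UNIV. - (a i j x * christoffel (g c) l i j x))" for l x
  \<comment> \<open>Used twice: with the components of the Hessian for \<open>C\<close> it gives the
    local expression of the operator, with the products of components of \<xi> it gives the
    symbol.\<close>
  have form: "- (lovelock_form k (g c) x (\<lambda>u v. \<Sum>i\<in>UNIV. \<Sum>j\<in>UNIV. u $ i * v $ j * C i j) bs bs / det (g c x))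
      = (\<Sum>i\<in>UNIV. \<Sum>j\<in>UNIV. a i j x * C i j)" for x C
    unfolding lovelock_form_components
    by (simp add: a_def w_def sum_divide_distrib sum_negf[symmetric] mult_ac)
  have smooth_a: "smooth_on (chart_image c) (a i j)" for i j
    unfolding a_def[abs_def] w_def[abs_def] using det_G
    by (intro smooth_on_minus smooth_on_divide smooth_lovelock_form smooth_on_det smooth_G open_U) force
  moreover have "smooth_on (chart_image c) (b l)" for l
    unfolding b_def[abs_def]
    by (intro smooth_on_sum smooth_on_minus smooth_on_mult smooth_a smooth_christoffel open_U)
  \<comment> \<open>The coefficient of order zero: the Hessian involves only derivatives of the
    function.\<close>
  moreover have "smooth_on (chart_image c) (\<lambda>x. 0)" by (rule smooth_on_const)
  moreover have "lovelock_operator A g k f (chart_inv c x) =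
      (\<Sum>i\<in>UNIV. \<Sum>j\<in>UNIV. a i j x * pderiv_at i (pderiv_at j (f \<circ> chart_inv c)) x)
      + (\<Sum>l\<in>UNIV. b l x * pderiv_at l (f \<circ> chart_inv c) x) + 0 * (f \<circ> chart_inv c) x"
    if "smooth_fun A f" "x \<in> chart_image c" for f x
  proof -
    let ?F = "f \<circ> chart_inv c"
    have "lovelock_operator A g k f (chart_inv c x) = (\<Sum>i\<in>UNIV. \<Sum>j\<in>UNIV. a i j x *
        (pderiv_at i (pderiv_at j ?F) x - (\<Sum>l\<in>UNIV. christoffel (g c) l i j x * pderiv_at l ?F x)))"
      unfolding lovelock_operator_in_chart[OF c that(2,1) es] bs_def[symmetric] hessian_components form ..
    also have "\<dots> = (\<Sum>i\<in>UNIV. \<Sum>j\<in>UNIV. a i j x * pderiv_at i (pderiv_at j ?F) x)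
        - (\<Sum>i\<in>UNIV. \<Sum>j\<in>UNIV. \<Sum>l\<in>UNIV. a i j x * christoffel (g c) l i j x * pderiv_at l ?F x)"
      by (simp add: right_diff_distrib sum_subtractf sum_distrib_left mult_ac)
    also have "(\<Sum>i\<in>UNIV. \<Sum>j\<in>UNIV. \<Sum>l\<in>UNIV. a i j x * christoffel (g c) l i j x * pderiv_at l ?F x)
        = (\<Sum>l\<in>UNIV. \<Sum>i\<in>UNIV. \<Sum>j\<in>UNIV. a i j x * christoffel (g c) l i j x * pderiv_at l ?F x)"
      by (rule sum_rotate3[symmetric])
    finally show ?thesis
      by (simp add: b_def sum_distrib_right sum_negf comp_def)
  qed
  moreover have "(\<Sum>i\<in>UNIV. \<Sum>j\<in>UNIV. a i j x * \<xi> $ i * \<xi> $ j) \<noteq> 0"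
    if x: "x \<in> chart_image c" and "\<xi> \<noteq> 0" for x and \<xi> :: "real^'n"
  proof -
    let ?B = "\<lambda>u v. (\<xi> \<bullet> u) * (\<xi> \<bullet> v)"
    obtain v where v: "v \<noteq> 0"
      "inner11 (bilin (g c x)) (einstein_lovelock k (g c) x) ?B = einstein_lovelock k (g c) x v v"
      using symbol_value[OF x \<open>\<xi> \<noteq> 0\<close>] .
    have B: "?B = (\<lambda>u v. \<Sum>i\<in>UNIV. \<Sum>j\<in>UNIV. u $ i * v $ j * (\<xi> $ i * \<xi> $ j))"
      by (simp add: inner_vec_def sum_product mult_ac)
    have "einstein_lovelock k (g c) x v v = lovelock_form k (g c) x ?B bs bs / det (g c x)"
      unfolding v(2)[symmetric] bs_def
      by (rule inner11_einstein_lovelock[OF x es]) (simp_all add: linear_iff algebra_simps inner_add_right)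
    then have "(\<Sum>i\<in>UNIV. \<Sum>j\<in>UNIV. a i j x * \<xi> $ i * \<xi> $ j) = - einstein_lovelock k (g c) x v v"
      using form[of x "\<lambda>i j. \<xi> $ i * \<xi> $ j"] unfolding B by (simp add: mult.assoc)
    \<comment> \<open>Either sign of definiteness excludes the value zero at the nonzero vector
      \<open>v\<close>.\<close>
    moreover have "einstein_lovelock k (g c) x v v \<noteq> 0"
      using assms(3) c x v(1) unfolding lovelock_positive_definite_def lovelock_negative_definite_def
      by (metis less_irrefl)
    ultimately show ?thesis by simp
  qed
  ultimately show "\<exists>(a :: 'n \<Rightarrow> 'n \<Rightarrow> real^'n \<Rightarrow> real) (b :: 'n \<Rightarrow> real^'n \<Rightarrow> real) (s :: real^'n \<Rightarrow> real).
        (\<forall>i j. smooth_on (chart_image c) (a i j)) \<and>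
        (\<forall>i. smooth_on (chart_image c) (b i)) \<and>
        smooth_on (chart_image c) s \<and>
        (\<forall>f. smooth_fun A f \<longrightarrow> (\<forall>x\<in>chart_image c.
           lovelock_operator A g k f (chart_inv c x) =
             (let F = f \<circ> chart_inv c
              in (\<Sum>i\<in>UNIV. \<Sum>j\<in>UNIV. a i j x * pderiv_at i (pderiv_at j F) x)
                 + (\<Sum>i\<in>UNIV. b i x * pderiv_at i F x) + s x * F x))) \<and>
        (\<forall>x\<in>chart_image c. \<forall>\<xi> :: real^'n. \<xi> \<noteq> 0 \<longrightarrow>
           (\<Sum>i\<in>UNIV. \<Sum>j\<in>UNIV. a i j x * \<xi> $ i * \<xi> $ j) \<noteq> 0)"
    unfolding Let_def by (intro exI[of _ a] exI[of _ b] exI[of _ "\<lambda>x. 0"]) blast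
qed

end
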